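(* Let $\mathbf K$ be as in the context and let $\downarrow$ be a simple independence relation in $\mathbf K$. If $\mu,\lambda$ are cardinals with $\operatorname{LS}(\mathbf K)\le\mu\le\lambda$, $\kappa(\downarrow)\le\mu$ and $\mu^{<\ell(\downarrow)}=\mu$, then \[ NT(\mu,\lambda,\aleph_0)\le\lambda^{\kappa(\downarrow)}+2^\mu. \] In particular $NT(\mu,\lambda,2)\le\lambda^{\kappa(\downarrow)}+2^\mu$.
   Context: $\mathbf{K}$ is an abstract elementary class (AEC) with strong substructure relation $\le_{\mathbf K}$ and Löwenheim–Skolem–Tarski number $\operatorname{LS}(\mathbf K)$, with joint embedding, amalgamation and no maximal models; we work in a monster model $\mathfrak C$. For a sequence $\mathbf b$ and $A\subseteq\mathfrak C$, the Galois-type $\mathbf{tp}(\mathbf b/A)$ is the orbit of $\mathbf b$ under automorphisms of $\mathfrak C$ fixing $A$ pointwise; $\mathbf S^\alpha(M)$ (resp. $\mathbf S^\alpha(A)$) is the set of Galois-types of length $\alpha$ over $M$ (resp. $A$), $\mathbf S(M)=\mathbf S^1(M)$, $\mathbf S^{<\infty}=\bigcup_\alpha\mathbf S^\alpha$. $q\ge p$ means $q$ extends $p$. $\mathbf K_\lambda$ is the class of models of size $\lambda$. A set of Galois-types is consistent if a single $a\in\mathfrak C$ realizes all of them, otherwise inconsistent. An independence relation is a relation $A\downarrow_M B$ ($M\le_{\mathbf K}\mathfrak C$, $A,B\subseteq\mathfrak C$) satisfying: invariance under automorphisms of $\mathfrak C$; monotonicity (shrinking $A$, $B$); normality ($A\downarrow_MB$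 iff $A\cup M\downarrow_MB\cup M$); base monotonicity (if $A\downarrow_MB$, $M\le_{\mathbf K}N$, $|N|\subseteq B$ then $A\downarrow_NB$); existence (every $p\in\mathbf S^{<\infty}(M)$ has, for each $N\ge_{\mathbf K}M$, an extension in $\mathbf S^{<\infty}(N)$ not forking over $M$); transitivity (if $M\le_{\mathbf K}N$, $A\downarrow_MN$, $A\downarrow_NB$ then $A\downarrow_MB$). "$\mathbf{tp}(\bar a/B)$ does not fork over $M$" means $\mathrm{ran}(\bar a)\downarrow_MB$. A simple independence relation is an independence relation satisfying: symmetry ($A\downarrow_MB$ iff $B\downarrow_MA$); type-amalgamation (if $p\in\mathbf S^{<\infty}(M)$, $M\subseteq A,B$, $A\downarrow_MB$, $N^*\in\mathbf K$ contains $A\cup B$, and $q_1\in\mathbf S^{<\infty}(A)$, $q_2\in\mathbf S^{<\infty}(B)$ both extend $p$ and do not fork over $M$, then there is $q\in\mathbf S^{<\infty}(N^* )$ extending $q_1$ and $q_2$ that does not fork over $M$); uniform local character (there are cardinals $\lambda,\theta$ such that every $p\in\mathbf S^\alpha(M)$ does not fork over some $M_0\le_{\mathbf K}M$ with $\|M_0\|\le\lambda+\alpha^{<\theta}$). $(\kappa(\downarrow),\ell(\downarrow))$ is the least such pair $(\lambda,\theta)$ in lexicographic order ($\lambda$ infinite, $\theta$ possibly finite). For $M\in\mathbf K$ and $\mu\le\|M\|$, $\mathbf S(M,\le\mu)=\{\mathbf{tp}(a/N):a\in\mathfrak C,\ N\le_{\mathbf K}M,\ \|N\|\le\mu\}$.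 For $\operatorname{LS}(\mathbf K)\le\mu\le\lambda$ and a cardinal $\kappa$, $NT(\mu,\lambda,\kappa)$ is the supremum of $|\Gamma|$ over all $\Gamma$ for which there is $M\in\mathbf K_\lambda$ with $\Gamma\subseteq\mathbf S(M,\le\mu)$ and every $\Delta\subseteq\Gamma$ with $|\Delta|\ge\kappa$ inconsistent. *)

theory Defs
  imports "HOL-Library.FuncSet"
begin

unbundle cardinal_syntax

section \<open>Cardinals\<close>

text \<open>Cardinals are well-orders satisfying \<^const>\<open>Card_order\<close>, compared by \<open>\<le>o\<close>, \<open><o\<close>, \<open>=o\<close>.
  A cardinal-valued operation is therefore only meaningful up to \<open>=o\<close>, and suprema and
  minima of cardinals are chosen representatives.\<close>

definition is_csup :: "'b rel set \<Rightarrow> 'b rel \<Rightarrow> bool" where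
  "is_csup S r \<longleftrightarrow> Card_order r \<and> (\<forall>s\<in>S. s \<le>o r) \<and>
     (\<forall>r' :: 'b rel. Card_order r' \<and> (\<forall>s\<in>S. s \<le>o r') \<longrightarrow> r \<le>o r')"

definition csup :: "'b rel set \<Rightarrow> 'b rel" where
  "csup S = (SOME r. is_csup S r)"

lemma is_csup_csup:
  fixes S :: "'b rel set"
  assumes "\<forall>s\<in>S. Card_order s"
  shows "is_csup S (csup S)"
proof -
  let ?U = "{r :: 'b rel. Card_order r \<and> (\<forall>s\<in>S. s \<le>o r)}"
  have bound: "|UNIV :: 'b set| \<in> ?U"
  proof (intro CollectI conjI ballI)
    show "Card_order |UNIV :: 'b set|" by (rule card_of_Card_order)
    fix s assume "s \<in> S"
    then have "|Field s| =o s" using assms card_of_Field_ordIso by blast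
    moreover have "|Field s| \<le>o |UNIV :: 'b set|" by (rule card_of_mono1[OF subset_UNIV])
    ultimately show "s \<le>o |UNIV :: 'b set|"
      using ordIso_ordLeq_trans ordIso_symmetric by blast
  qed
  have "\<exists>r\<in>?U. \<forall>r'\<in>?U. r \<le>o r'"
    using exists_minim_Well_order[of ?U] bound card_order_on_well_order_on by blast
  then have "\<exists>r. is_csup S r" unfolding is_csup_def by blast
  then show ?thesis unfolding csup_def by (rule someI_ex)
qed

text \<open>\<open>cpow_less \<alpha> \<theta>\<close> is \<open>\<alpha>\<close> to the power \<open><\<theta>\<close>, the supremum of the \<open>\<alpha> ^c \<nu>\<close> for \<open>\<nu> <o \<theta>\<close>
  (not the number of sequences of length \<open>< \<theta>\<close>, which differs when \<open>\<alpha> = 1\<close>).\<close>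

definition cpow_less :: "'a rel \<Rightarrow> 'a rel \<Rightarrow> ('a \<Rightarrow> 'a) rel" where
  "cpow_less \<alpha> \<theta> = csup {\<alpha> ^c \<nu> | \<nu> :: 'a rel. Card_order \<nu> \<and> \<nu> <o \<theta>}"


section \<open>Structures in a finitary vocabulary\<close>

record ('f, 'r) vocabulary =
  funs :: "'f set"
  rels :: "'r set"
  farity :: "'f \<Rightarrow> nat"
  rarity :: "'r \<Rightarrow> nat"

record ('a, 'f, 'r) struct =
  univ :: "'a set"
  fint :: "'f \<Rightarrow> 'a list \<Rightarrow> 'a"
  rint :: "'r \<Rightarrow> 'a list set"

definition tuples :: "'a set \<Rightarrow> nat \<Rightarrow> 'a list set" where
  "tuples A n = {xs. set xs \<subseteq> A \<and> length xs = n}"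

text \<open>Interpretations are fixed outside their domain, so that equality of records is
  equality of structures.\<close>

definition is_struct :: "('f, 'r) vocabulary \<Rightarrow> ('a, 'f, 'r) struct \<Rightarrow> bool" where
  "is_struct \<tau> M \<longleftrightarrow> univ M \<noteq> {} \<and>
     (\<forall>f xs. if f \<in> funs \<tau> \<and> xs \<in> tuples (univ M) (farity \<tau> f)
             then fint M f xs \<in> univ M else fint M f xs = undefined) \<and>
     (\<forall>R. rint M R \<subseteq> (if R \<in> rels \<tau> then tuples (univ M) (rarity \<tau> R) else {}))"

definition substruct :: "('f, 'r) vocabulary \<Rightarrow> ('a, 'f, 'r) struct \<Rightarrow> ('a, 'f, 'r) struct \<Rightarrow> bool" where
  "substruct \<tau> M N \<longleftrightarrow> is_struct \<tau> M \<and> is_struct \<tau> N \<and> univ M \<subseteq> univ N \<and>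
     (\<forall>f\<in>funs \<tau>. \<forall>xs\<in>tuples (univ M) (farity \<tau> f). fint M f xs = fint N f xs) \<and>
     (\<forall>R\<in>rels \<tau>. \<forall>xs\<in>tuples (univ M) (rarity \<tau> R). xs \<in> rint M R \<longleftrightarrow> xs \<in> rint N R)"

definition struct_iso ::
  "('f, 'r) vocabulary \<Rightarrow> ('a \<Rightarrow> 'a) \<Rightarrow> ('a, 'f, 'r) struct \<Rightarrow> ('a, 'f, 'r) struct \<Rightarrow> bool" where
  "struct_iso \<tau> h M N \<longleftrightarrow> is_struct \<tau> M \<and> is_struct \<tau> N \<and> bij_betw h (univ M) (univ N) \<and>
     (\<forall>f\<in>funs \<tau>. \<forall>xs\<in>tuples (univ M) (farity \<tau> f). h (fint M f xs) = fint N f (map h xs)) \<and>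
     (\<forall>R\<in>rels \<tau>. \<forall>xs\<in>tuples (univ M) (rarity \<tau> R). xs \<in> rint M R \<longleftrightarrow> map h xs \<in> rint N R)"

definition union_struct :: "('f, 'r) vocabulary \<Rightarrow> ('a, 'f, 'r) struct set \<Rightarrow> ('a, 'f, 'r) struct" where
  "union_struct \<tau> \<M> =
     \<lparr>univ = (\<Union>M\<in>\<M>. univ M),
      fint = (\<lambda>f xs. if f \<in> funs \<tau> \<and> xs \<in> tuples (\<Union>M\<in>\<M>. univ M) (farity \<tau> f)
                     then THE y. \<exists>M\<in>\<M>. set xs \<subseteq> univ M \<and> y = fint M f xs
                     else undefined),
      rint = (\<lambda>R. \<Union>M\<in>\<M>. rint M R)\<rparr>"


section \<open>Abstract elementary classes\<close>

text \<open>All models live on subsets of one type \<^typ>\<open>'a\<close>; up to isomorphism these are the members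
  of the class of cardinality at most that of \<^typ>\<open>'a\<close>, so that type plays the role of a
  universe large enough to contain the monster model.\<close>

record ('a, 'f, 'r) aclass =
  voc :: "('f, 'r) vocabulary"
  models :: "('a, 'f, 'r) struct set"
  strong :: "('a, 'f, 'r) struct \<Rightarrow> ('a, 'f, 'r) struct \<Rightarrow> bool"

definition LST_bound :: "('a, 'f, 'r) aclass \<Rightarrow> 'a rel \<Rightarrow> bool" where
  "LST_bound K \<mu> \<longleftrightarrow> Card_order \<mu> \<and> natLeq \<le>o \<mu> \<and> |funs (voc K)| +c |rels (voc K)| \<le>o \<mu> \<and>
     (\<forall>M\<in>models K. \<forall>A\<subseteq>univ M. \<exists>M0. strong K M0 M \<and> A \<subseteq> univ M0 \<and> |univ M0| \<le>o |A| +c \<mu>)"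

definition LS :: "('a, 'f, 'r) aclass \<Rightarrow> 'a rel" where
  "LS K = (SOME \<mu>. LST_bound K \<mu> \<and> (\<forall>\<mu>'. LST_bound K \<mu>' \<longrightarrow> \<mu> \<le>o \<mu>'))"

text \<open>The limit ordinals indexing chains are well-orders \<open>r\<close> of subsets of \<^typ>\<open>'a\<close>; these
  suffice, since a strictly increasing chain of subsets of an infinite type \<^typ>\<open>'a\<close> has
  length less than the successor of the cardinality of \<^typ>\<open>'a\<close>.\<close>

definition increasing_chain ::
  "('a, 'f, 'r) aclass \<Rightarrow> 'a rel \<Rightarrow> ('a \<Rightarrow> ('a, 'f, 'r) struct) \<Rightarrow> bool" where
  "increasing_chain K r \<M> \<longleftrightarrow>
     Well_order r \<and> Field r \<noteq> {} \<and> (\<forall>i\<in>Field r. \<exists>j. (i, j) \<in> r \<and> j \<noteq> i) \<and>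
     (\<forall>i\<in>Field r. \<M> i \<in> models K) \<and> (\<forall>i j. (i, j) \<in> r \<longrightarrow> strong K (\<M> i) (\<M> j))"

definition aec :: "('a, 'f, 'r) aclass \<Rightarrow> bool" where
  "aec K \<longleftrightarrow>
     (\<forall>M\<in>models K. is_struct (voc K) M) \<and>
     (\<forall>M N. strong K M N \<longrightarrow> M \<in> models K \<and> N \<in> models K \<and> substruct (voc K) M N) \<and>
     \<comment> \<open>partial order\<close>
     (\<forall>M\<in>models K. strong K M M) \<and>
     (\<forall>M N. strong K M N \<and> strong K N M \<longrightarrow> M = N) \<and>
     (\<forall>M N P. strong K M N \<and> strong K N P \<longrightarrow> strong K M P) \<and>
     \<comment> \<open>closure under isomorphism\<close>
     (\<forall>M N h. M \<in> models K \<and> struct_iso (voc K) h M N \<longrightarrow> N \<in> models K) \<and>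
     (\<forall>M N M' N' h. strong K M N \<and> struct_iso (voc K) h N N' \<and> struct_iso (voc K) h M M' \<and>
        substruct (voc K) M' N' \<longrightarrow> strong K M' N') \<and>
     \<comment> \<open>coherence\<close>
     (\<forall>M0 M1 M2. strong K M0 M2 \<and> strong K M1 M2 \<and> substruct (voc K) M0 M1 \<longrightarrow> strong K M0 M1) \<and>
     \<comment> \<open>Tarski--Vaught axioms\<close>
     (\<forall>r \<M>. increasing_chain K r \<M> \<longrightarrow>
        union_struct (voc K) (\<M> ` Field r) \<in> models K \<and>
        (\<forall>i\<in>Field r. strong K (\<M> i) (union_struct (voc K) (\<M> ` Field r))) \<and>
        (\<forall>N. (\<forall>i\<in>Field r. strong K (\<M> i) N) \<longrightarrow>
           strong K (union_struct (voc K) (\<M> ` Field r)) N)) \<and>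
     \<comment> \<open>Loewenheim--Skolem--Tarski axiom\<close>
     (\<exists>\<mu>. LST_bound K \<mu>)"

definition K_embedding ::
  "('a, 'f, 'r) aclass \<Rightarrow> ('a \<Rightarrow> 'a) \<Rightarrow> ('a, 'f, 'r) struct \<Rightarrow> ('a, 'f, 'r) struct \<Rightarrow> bool" where
  "K_embedding K h M N \<longleftrightarrow> M \<in> models K \<and> (\<exists>M'. strong K M' N \<and> struct_iso (voc K) h M M')"

definition joint_embedding :: "('a, 'f, 'r) aclass \<Rightarrow> bool" where
  "joint_embedding K \<longleftrightarrow> (\<forall>M1\<in>models K. \<forall>M2\<in>models K.
     \<exists>N h1 h2. K_embedding K h1 M1 N \<and> K_embedding K h2 M2 N)"

definition amalgamation :: "('a, 'f, 'r) aclass \<Rightarrow> bool" where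
  "amalgamation K \<longleftrightarrow> (\<forall>M0 M1 M2. strong K M0 M1 \<and> strong K M0 M2 \<longrightarrow>
     (\<exists>N h1 h2. K_embedding K h1 M1 N \<and> K_embedding K h2 M2 N \<and>
        (\<forall>x\<in>univ M0. h1 x = h2 x)))"

text \<open>A model whose universe is all of \<^typ>\<open>'a\<close> has no proper extension literally containing it,
  hence proper extensions are taken up to isomorphism.\<close>

definition no_maximal_models :: "('a, 'f, 'r) aclass \<Rightarrow> bool" where
  "no_maximal_models K \<longleftrightarrow> (\<forall>M\<in>models K. \<exists>N h. K_embedding K h M N \<and> h ` univ M \<noteq> univ N)"


section \<open>The monster model and Galois types\<close>

definition Aut ::
  "('a, 'f, 'r) aclass \<Rightarrow> ('a, 'f, 'r) struct \<Rightarrow> 'a set \<Rightarrow> ('a \<Rightarrow> 'a) set" where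
  "Aut K C A = {\<sigma>. struct_iso (voc K) \<sigma> C C \<and> (\<forall>a\<in>A. \<sigma> a = a)}"

text \<open>The monster model \<open>C\<close> is universal and strongly model-homogeneous for small models, small
  meaning of cardinality less than that of \<open>C\<close>. As usual, all models and all sets of
  parameters considered below are small and contained in \<open>C\<close>.\<close>

definition small_set :: "('a, 'f, 'r) struct \<Rightarrow> 'a set \<Rightarrow> bool" where
  "small_set C A \<longleftrightarrow> A \<subseteq> univ C \<and> |A| <o |univ C|"

definition small_model :: "('a, 'f, 'r) aclass \<Rightarrow> ('a, 'f, 'r) struct \<Rightarrow> ('a, 'f, 'r) struct \<Rightarrow> bool" where
  "small_model K C M \<longleftrightarrow> strong K M C \<and> |univ M| <o |univ C|"

definition monster :: "('a, 'f, 'r) aclass \<Rightarrow> ('a, 'f, 'r) struct \<Rightarrow> bool" where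
  "monster K C \<longleftrightarrow> C \<in> models K \<and>
     (\<forall>M\<in>models K. |univ M| <o |univ C| \<longrightarrow> (\<exists>h. K_embedding K h M C)) \<and>
     (\<forall>M N h. small_model K C M \<and> small_model K C N \<and> struct_iso (voc K) h M N \<longrightarrow>
        (\<exists>\<sigma>\<in>Aut K C {}. \<forall>x\<in>univ M. \<sigma> x = h x))"

text \<open>The ordinal length of a sequence is a well-order \<open>\<alpha>\<close> with small field, and a sequence of
  length \<open>\<alpha>\<close> is an (extensional) function on \<^term>\<open>Field \<alpha>\<close>.\<close>

definition small_ordinal :: "('a, 'f, 'r) struct \<Rightarrow> 'a rel \<Rightarrow> bool" where
  "small_ordinal C \<alpha> \<longleftrightarrow> Well_order \<alpha> \<and> |Field \<alpha>| <o |univ C|"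

definition seqs :: "('a, 'f, 'r) struct \<Rightarrow> 'a rel \<Rightarrow> ('a \<Rightarrow> 'a) set" where
  "seqs C \<alpha> = Field \<alpha> \<rightarrow>\<^sub>E univ C"

definition gtp ::
  "('a, 'f, 'r) aclass \<Rightarrow> ('a, 'f, 'r) struct \<Rightarrow> 'a rel \<Rightarrow> ('a \<Rightarrow> 'a) \<Rightarrow> 'a set \<Rightarrow> ('a \<Rightarrow> 'a) set" where
  "gtp K C \<alpha> b A = {compose (Field \<alpha>) \<sigma> b | \<sigma>. \<sigma> \<in> Aut K C A}"

definition gS ::
  "('a, 'f, 'r) aclass \<Rightarrow> ('a, 'f, 'r) struct \<Rightarrow> 'a rel \<Rightarrow> 'a set \<Rightarrow> ('a \<Rightarrow> 'a) set set" where
  "gS K C \<alpha> A = {gtp K C \<alpha> b A | b. b \<in> seqs C \<alpha>}"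

text \<open>\<open>q\<close>, a type over \<open>B\<close>, extends \<open>p\<close>, a type over \<open>A\<close>. Orbits do not determine their domain,
  so domains are passed explicitly.\<close>

definition extends ::
  "('a, 'f, 'r) aclass \<Rightarrow> ('a, 'f, 'r) struct \<Rightarrow> 'a rel \<Rightarrow>
     ('a \<Rightarrow> 'a) set \<Rightarrow> 'a set \<Rightarrow> ('a \<Rightarrow> 'a) set \<Rightarrow> 'a set \<Rightarrow> bool" where
  "extends K C \<alpha> q B p A \<longleftrightarrow> A \<subseteq> B \<and> (\<exists>b\<in>seqs C \<alpha>. q = gtp K C \<alpha> b B \<and> p = gtp K C \<alpha> b A)"

text \<open>Types of single elements, with an element identified with the sequence of length one.\<close>

definition gtp1 ::
  "('a, 'f, 'r) aclass \<Rightarrow> ('a, 'f, 'r) struct \<Rightarrow> 'a \<Rightarrow> 'a set \<Rightarrow> 'a set" where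
  "gtp1 K C a A = {\<sigma> a | \<sigma>. \<sigma> \<in> Aut K C A}"

definition consistent :: "('a, 'f, 'r) struct \<Rightarrow> 'a set set \<Rightarrow> bool" where
  "consistent C \<Delta> \<longleftrightarrow> (\<exists>a\<in>univ C. \<forall>p\<in>\<Delta>. a \<in> p)"

definition S_le ::
  "('a, 'f, 'r) aclass \<Rightarrow> ('a, 'f, 'r) struct \<Rightarrow> ('a, 'f, 'r) struct \<Rightarrow> 'a rel \<Rightarrow> 'a set set" where
  "S_le K C M \<mu> = {gtp1 K C a (univ N) | a N. a \<in> univ C \<and> strong K N M \<and> |univ N| \<le>o \<mu>}"

definition NT ::
  "('a, 'f, 'r) aclass \<Rightarrow> ('a, 'f, 'r) struct \<Rightarrow> 'a rel \<Rightarrow> 'a rel \<Rightarrow> 'k rel \<Rightarrow> 'a set rel" where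
  "NT K C \<mu> lam \<kappa> = csup (card_of ` {\<Gamma>. \<exists>M. strong K M C \<and> |univ M| =o lam \<and> \<Gamma> \<subseteq> S_le K C M \<mu> \<and>
     (\<forall>\<Delta>\<subseteq>\<Gamma>. \<kappa> \<le>o |\<Delta>| \<longrightarrow> \<not> consistent C \<Delta>)})"


section \<open>Independence relations\<close>

text \<open>\<open>ind A M B\<close> stands for: \<open>A\<close> is independent from \<open>B\<close> over \<open>M\<close>.\<close>

type_synonym ('a, 'f, 'r) indep = "'a set \<Rightarrow> ('a, 'f, 'r) struct \<Rightarrow> 'a set \<Rightarrow> bool"

definition nonforking ::
  "('a, 'f, 'r) aclass \<Rightarrow> ('a, 'f, 'r) struct \<Rightarrow> ('a, 'f, 'r) indep \<Rightarrow> 'a rel \<Rightarrow>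
     ('a \<Rightarrow> 'a) set \<Rightarrow> 'a set \<Rightarrow> ('a, 'f, 'r) struct \<Rightarrow> bool" where
  "nonforking K C ind \<alpha> p B M \<longleftrightarrow>
     (\<exists>b\<in>seqs C \<alpha>. p = gtp K C \<alpha> b B \<and> ind (b ` Field \<alpha>) M B)"

definition independence_relation ::
  "('a, 'f, 'r) aclass \<Rightarrow> ('a, 'f, 'r) struct \<Rightarrow> ('a, 'f, 'r) indep \<Rightarrow> bool" where
  "independence_relation K C ind \<longleftrightarrow>
     \<comment> \<open>invariance\<close>
     (\<forall>\<sigma>\<in>Aut K C {}. \<forall>A M B M'. small_set C A \<and> small_set C B \<and>
        small_model K C M \<and> small_model K C M' \<and> struct_iso (voc K) \<sigma> M M' \<longrightarrow>
        (ind A M B \<longleftrightarrow> ind (\<sigma> ` A) M' (\<sigma> ` B))) \<and>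
     \<comment> \<open>monotonicity\<close>
     (\<forall>A M B A' B'. small_set C A \<and> small_set C B \<and> small_model K C M \<and>
        ind A M B \<and> A' \<subseteq> A \<and> B' \<subseteq> B \<longrightarrow> ind A' M B') \<and>
     \<comment> \<open>normality\<close>
     (\<forall>A M B. small_set C A \<and> small_set C B \<and> small_model K C M \<longrightarrow>
        (ind A M B \<longleftrightarrow> ind (A \<union> univ M) M (B \<union> univ M))) \<and>
     \<comment> \<open>base monotonicity\<close>
     (\<forall>A M B N. small_set C A \<and> small_set C B \<and> small_model K C M \<and> small_model K C N \<and>
        ind A M B \<and> strong K M N \<and> univ N \<subseteq> B \<longrightarrow> ind A N B) \<and>
     \<comment> \<open>existence\<close>
     (\<forall>\<alpha> M N. \<forall>p\<in>gS K C \<alpha> (univ M). small_ordinal C \<alpha> \<and> small_model K C M \<and>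
        small_model K C N \<and> strong K M N \<longrightarrow>
        (\<exists>q\<in>gS K C \<alpha> (univ N). extends K C \<alpha> q (univ N) p (univ M) \<and>
           nonforking K C ind \<alpha> q (univ N) M)) \<and>
     \<comment> \<open>transitivity\<close>
     (\<forall>A M N B. small_set C A \<and> small_set C B \<and> small_model K C M \<and> small_model K C N \<and>
        strong K M N \<and> ind A M (univ N) \<and> ind A N B \<longrightarrow> ind A M B)"

definition symmetric_ind ::
  "('a, 'f, 'r) aclass \<Rightarrow> ('a, 'f, 'r) struct \<Rightarrow> ('a, 'f, 'r) indep \<Rightarrow> bool" where
  "symmetric_ind K C ind \<longleftrightarrow>
     (\<forall>A M B. small_set C A \<and> small_set C B \<and> small_model K C M \<longrightarrow> (ind A M B \<longleftrightarrow> ind B M A))"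

definition type_amalgamation ::
  "('a, 'f, 'r) aclass \<Rightarrow> ('a, 'f, 'r) struct \<Rightarrow> ('a, 'f, 'r) indep \<Rightarrow> bool" where
  "type_amalgamation K C ind \<longleftrightarrow>
     (\<forall>\<alpha> M A B N' p q1 q2.
        small_ordinal C \<alpha> \<and> small_model K C M \<and> small_set C A \<and> small_set C B \<and>
        small_model K C N' \<and> p \<in> gS K C \<alpha> (univ M) \<and>
        univ M \<subseteq> A \<and> univ M \<subseteq> B \<and> ind A M B \<and> A \<union> B \<subseteq> univ N' \<and>
        q1 \<in> gS K C \<alpha> A \<and> q2 \<in> gS K C \<alpha> B \<and>
        extends K C \<alpha> q1 A p (univ M) \<and> extends K C \<alpha> q2 B p (univ M) \<and>
        nonforking K C ind \<alpha> q1 A M \<and> nonforking K C ind \<alpha> q2 B M \<longrightarrow>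
        (\<exists>q\<in>gS K C \<alpha> (univ N'). extends K C \<alpha> q (univ N') q1 A \<and>
           extends K C \<alpha> q (univ N') q2 B \<and> nonforking K C ind \<alpha> q (univ N') M))"

text \<open>The cardinals witnessing uniform local character are small as well: for an exponent bound
  \<open>\<theta>\<close> as large as the monster model the condition would be void for sequences of length \<open>\<ge> 2\<close>.\<close>

definition local_character_bound ::
  "('a, 'f, 'r) aclass \<Rightarrow> ('a, 'f, 'r) struct \<Rightarrow> ('a, 'f, 'r) indep \<Rightarrow> 'a rel \<times> 'a rel \<Rightarrow> bool" where
  "local_character_bound K C ind = (\<lambda>(\<kappa>, \<theta>).
     Card_order \<kappa> \<and> cinfinite \<kappa> \<and> \<kappa> <o |univ C| \<and> Card_order \<theta> \<and> \<theta> <o |univ C| \<and>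
     (\<forall>\<alpha> M. \<forall>p\<in>gS K C \<alpha> (univ M). small_ordinal C \<alpha> \<and> small_model K C M \<longrightarrow>
        (\<exists>M0. strong K M0 M \<and> |univ M0| \<le>o \<kappa> +c cpow_less |Field \<alpha>| \<theta> \<and>
           nonforking K C ind \<alpha> p (univ M) M0)))"

definition simple_independence_relation ::
  "('a, 'f, 'r) aclass \<Rightarrow> ('a, 'f, 'r) struct \<Rightarrow> ('a, 'f, 'r) indep \<Rightarrow> bool" where
  "simple_independence_relation K C ind \<longleftrightarrow>
     independence_relation K C ind \<and> symmetric_ind K C ind \<and> type_amalgamation K C ind \<and>
     (\<exists>\<kappa> \<theta>. local_character_bound K C ind (\<kappa>, \<theta>))"

definition lex_le :: "'a rel \<times> 'a rel \<Rightarrow> 'a rel \<times> 'a rel \<Rightarrow> bool" where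
  "lex_le x y \<longleftrightarrow> fst x <o fst y \<or> (fst x =o fst y \<and> snd x \<le>o snd y)"

definition local_character_pair ::
  "('a, 'f, 'r) aclass \<Rightarrow> ('a, 'f, 'r) struct \<Rightarrow> ('a, 'f, 'r) indep \<Rightarrow> 'a rel \<times> 'a rel" where
  "local_character_pair K C ind = (SOME x. local_character_bound K C ind x \<and>
     (\<forall>y. local_character_bound K C ind y \<longrightarrow> lex_le x y))"

definition kappa_ind ::
  "('a, 'f, 'r) aclass \<Rightarrow> ('a, 'f, 'r) struct \<Rightarrow> ('a, 'f, 'r) indep \<Rightarrow> 'a rel" where
  "kappa_ind K C ind = fst (local_character_pair K C ind)"

definition ell_ind ::
  "('a, 'f, 'r) aclass \<Rightarrow> ('a, 'f, 'r) struct \<Rightarrow> ('a, 'f, 'r) indep \<Rightarrow> 'a rel" where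
  "ell_ind K C ind = snd (local_character_pair K C ind)"

end

theory Submission
  imports Defs
begin

text \<open>
  Suppose \<open>\<Gamma>\<close> is a set of more than \<open>lam ^c \<kappa> +c ctwo ^c \<mu>\<close> types over submodels of \<open>M\<close> of size at most
  \<open>\<mu>\<close>. By local character, existence and transitivity every \<open>p \<in> \<Gamma>\<close> is the type over some \<open>N\<^sub>p\<close> of an
  element \<open>a\<^sub>p\<close> that is independent from \<open>M\<close> over a model of size at most \<open>\<kappa>\<close>, and by the pigeonhole
  principle this model may be taken to be the same \<open>M\<^sub>0\<close> for more than \<open>ctwo ^c \<mu>\<close> of the \<open>p\<close>.

  There are a model \<open>B \<ge> M\<^sub>0\<close> of size at most \<open>\<mu>\<close> and a type \<open>c\<close> over \<open>B\<close> such that for every \<open>A \<ge> B\<close> in \<open>M\<close>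
  of size at most \<open>\<mu>\<close> infinitely many \<open>p\<close> satisfy \<open>tp(a\<^sub>p/B) = c\<close> and \<open>N\<^sub>p\<close> independent from \<open>A\<close> over
  \<open>B\<close>. Otherwise choose a counterexample \<open>A(B, c)\<close> for all \<open>B\<close> and \<open>c\<close>, and let \<open>D \<le> M\<close>, the union of a
  chain of length \<open>cardSuc \<mu>\<close>, have size at most \<open>ctwo ^c \<mu>\<close> and be closed under \<open>A\<close>. Only \<open>ctwo ^c \<mu>\<close> many
  \<open>p\<close> are exceptional for some \<open>B \<le> D\<close> and \<open>c\<close>; for any other \<open>p\<close>, local character applied to
  \<open>tp(N\<^sub>p/D)\<close> gives a \<open>B \<le> D\<close> contradicting the choice of \<open>A(B, tp(a\<^sub>p/B))\<close>.

  Starting from \<open>B\<close>, type-amalgamation now yields infinitely many \<open>p\<^sub>n\<close> and an increasing \<open>\<omega>\<close>-chain of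
  types over submodels of \<open>M\<close> whose \<open>(n+1)\<close>-st member extends \<open>p\<^sub>0, \<dots>, p\<^sub>n\<close>. In an AEC such a chain of
  length \<open>\<omega>\<close> has a common realization, so \<open>\<Gamma>\<close> has an infinite consistent subset.
\<close>

section \<open>Cardinal arithmetic\<close>

lemma csup_upper:
  fixes S :: "'b rel set"
  assumes "\<forall>s\<in>S. Card_order s" and "s \<in> S"
  shows "s \<le>o csup S"
  using is_csup_csup[OF assms(1)] assms(2) unfolding is_csup_def by blast

lemma Card_order_csup:
  fixes S :: "'b rel set"
  assumes "\<forall>s\<in>S. Card_order s"
  shows "Card_order (csup S)"
  using is_csup_csup[OF assms(1)] unfolding is_csup_def by blast

text \<open>\<open>csup S\<close> is minimal only among cardinals on the type of its members,
  whereas \<open>R\<close> may live on another type. If \<open>R\<close> is at most the cardinality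
  of the former type, it has a copy there; otherwise it exceeds every cardinal on that type.\<close>

lemma csup_least:
  fixes S :: "'b rel set" and R :: "'c rel"
  assumes S: "\<forall>s\<in>S. Card_order s" and le: "\<forall>s\<in>S. s \<le>o R" and R: "Card_order R"
  shows "csup S \<le>o R"
proof (cases "R \<le>o |UNIV :: 'b set|")
  case True
  have RF: "|Field R| =o R" using R by (rule card_of_Field_ordIso)
  then have "|Field R| \<le>o |UNIV :: 'b set|" using True by (rule ordIso_ordLeq_trans)
  then obtain B :: "'b set" where B: "|Field R| =o |B|"
    using internalize_card_of_ordLeq2[of "Field R" "UNIV :: 'b set"] by blast
  have RB: "R =o |B|" using ordIso_symmetric[OF RF] B by (rule ordIso_transitive)
  then have "\<forall>s\<in>S. s \<le>o |B|" using le ordLeq_ordIso_trans[OF _ RB] by blast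
  then have "csup S \<le>o |B|"
    using is_csup_csup[OF S] card_of_Card_order unfolding is_csup_def by blast
  then show ?thesis using ordIso_symmetric[OF RB] by (rule ordLeq_ordIso_trans)
next
  case False
  have "|UNIV :: 'b set| \<le>o R"
    using False ordLeq_total[OF card_of_Well_order card_order_on_well_order_on[OF R]] by blast
  moreover have "csup S \<le>o |UNIV :: 'b set|"
  proof -
    have "csup S =o |Field (csup S)|"
      by (rule ordIso_symmetric[OF card_of_Field_ordIso[OF Card_order_csup[OF S]]])
    then show ?thesis using card_of_mono1[OF subset_UNIV] by (rule ordIso_ordLeq_trans)
  qed
  ultimately show ?thesis using ordLeq_transitive by metis
qed

lemma cpow_less_mono1:
  fixes \<alpha> \<beta> \<theta> :: "'a rel"
  assumes "\<alpha> \<le>o \<beta>"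
  shows "cpow_less \<alpha> \<theta> \<le>o cpow_less \<beta> \<theta>"
  unfolding cpow_less_def
proof (rule csup_least)
  show "\<forall>s\<in>{\<alpha> ^c \<nu> |\<nu> :: 'a rel. Card_order \<nu> \<and> \<nu> <o \<theta>}. Card_order s"
    using Card_order_cexp by blast
  have co: "\<forall>s\<in>{\<beta> ^c \<nu> |\<nu> :: 'a rel. Card_order \<nu> \<and> \<nu> <o \<theta>}. Card_order s"
    using Card_order_cexp by blast
  show "\<forall>s\<in>{\<alpha> ^c \<nu> |\<nu> :: 'a rel. Card_order \<nu> \<and> \<nu> <o \<theta>}.
      s \<le>o csup {\<beta> ^c \<nu> |\<nu> :: 'a rel. Card_order \<nu> \<and> \<nu> <o \<theta>}"
  proof
    fix s assume "s \<in> {\<alpha> ^c \<nu> |\<nu> :: 'a rel. Card_order \<nu> \<and> \<nu> <o \<theta>}"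
    then obtain \<nu> :: "'a rel" where \<nu>: "s = \<alpha> ^c \<nu>" "Card_order \<nu>" "\<nu> <o \<theta>" by blast
    have "s \<le>o \<beta> ^c \<nu>" unfolding \<nu>(1) by (rule cexp_mono1[OF assms \<nu>(2)])
    moreover have "\<beta> ^c \<nu> \<le>o csup {\<beta> ^c \<nu> |\<nu> :: 'a rel. Card_order \<nu> \<and> \<nu> <o \<theta>}"
      by (rule csup_upper[OF co]) (use \<nu> in blast)
    ultimately show "s \<le>o csup {\<beta> ^c \<nu> |\<nu> :: 'a rel. Card_order \<nu> \<and> \<nu> <o \<theta>}"
      by (rule ordLeq_transitive)
  qed
  show "Card_order (csup {\<beta> ^c \<nu> |\<nu> :: 'a rel. Card_order \<nu> \<and> \<nu> <o \<theta>})"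
    by (rule Card_order_csup[OF co])
qed

text \<open>All powers of one are at most one, so for sequences of length one the local character
  bound collapses to its infinite summand, whatever \<theta> is.\<close>

lemma cpow_less_singleton:
  fixes x :: 'a
  shows "cpow_less |{x}| \<theta> \<le>o cone"
  unfolding cpow_less_def
proof (rule csup_least)
  show "\<forall>s\<in>{|{x}| ^c \<nu> |\<nu> :: 'a rel. Card_order \<nu> \<and> \<nu> <o \<theta>}. Card_order s"
    using Card_order_cexp by blast
  show "\<forall>s\<in>{|{x}| ^c \<nu> |\<nu> :: 'a rel. Card_order \<nu> \<and> \<nu> <o \<theta>}. s \<le>o cone"
  proof clarify
    fix \<nu> :: "'a rel"
    have "inj_on (\<lambda>_. ()) (Func (Field \<nu>) {x})"
      by (rule inj_onI) (auto simp: Func_def fun_eq_iff, metis)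
    then show "|{x}| ^c \<nu> \<le>o cone"
      unfolding cexp_def cone_def Field_card_of by (intro card_of_ordLeqI) auto
  qed
  show "Card_order cone" by (rule Card_order_cone)
qed

section \<open>Counting small subsets, tuples, lists and power sets\<close>

lemma card_of_le_imp_surj:
  assumes "|U| \<le>o |I|" and "U \<noteq> {}"
  obtains e where "e ` I = U"
  using that assms(1) card_of_ordLeq2[OF assms(2), of I] by blast

text \<open>Such a subset is the range of a function from \<open>Field r\<close> to
  \<open>A\<close>. The empty set is left out because it is not such a range when
  \<open>Field r\<close> is nonempty; universes of models are never empty.\<close>

lemma card_of_small_subsets:
  assumes "Card_order r"
  shows "|{U. U \<subseteq> A \<and> U \<noteq> {} \<and> |U| \<le>o r}| \<le>o |A| ^c r"
proof -
  have "{U. U \<subseteq> A \<and> U \<noteq> {} \<and> |U| \<le>o r} \<subseteq> (\<lambda>f. f ` Field r) ` Func (Field r) A"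
  proof
    fix U assume "U \<in> {U. U \<subseteq> A \<and> U \<noteq> {} \<and> |U| \<le>o r}"
    then have U: "U \<subseteq> A" "U \<noteq> {}" "|U| \<le>o r" by auto
    have "|U| \<le>o |Field r|"
      using U(3) ordIso_symmetric[OF card_of_Field_ordIso[OF assms]] by (rule ordLeq_ordIso_trans)
    then obtain e where e: "e ` Field r = U" using U(2) by (rule card_of_le_imp_surj)
    let ?f = "\<lambda>i. if i \<in> Field r then e i else undefined"
    have "?f ` Field r = U" using e by auto
    moreover have "?f \<in> Func (Field r) A" using e U(1) by (auto simp: Func_def)
    ultimately show "U \<in> (\<lambda>f. f ` Field r) ` Func (Field r) A" by blast
  qed
  then show ?thesis
    unfolding cexp_def Field_card_of by (rule surj_imp_ordLeq)
qed

lemma card_of_Times_Cinfinite_bound: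
  assumes "|A| \<le>o r" and "|B| \<le>o r" and "Cinfinite r"
  shows "|A \<times> B| \<le>o r"
  by (rule card_of_Times_ordLeq_infinite_Field) (use assms in \<open>auto simp: cinfinite_def\<close>)

lemma card_of_tuples:
  assumes "|A| \<le>o r" and "Cinfinite r"
  shows "|tuples A n| \<le>o r"
proof (induction n)
  case 0
  have "tuples A 0 = {[]}" by (auto simp: tuples_def)
  then show ?case
    using assms(2) by (metis Card_order_singl_ordLeq cinfinite_def finite.emptyI)
next
  case (Suc n)
  have "tuples A (Suc n) \<subseteq> (\<lambda>(x, xs). x # xs) ` (A \<times> tuples A n)"
  proof
    fix ys assume "ys \<in> tuples A (Suc n)"
    then obtain x xs where "ys = x # xs" "x \<in> A" "xs \<in> tuples A n"
      by (cases ys) (auto simp: tuples_def)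
    then show "ys \<in> (\<lambda>(x, xs). x # xs) ` (A \<times> tuples A n)" by auto
  qed
  then have "|tuples A (Suc n)| \<le>o |A \<times> tuples A n|" by (rule surj_imp_ordLeq)
  also have "|A \<times> tuples A n| \<le>o r"
    by (rule card_of_Times_Cinfinite_bound[OF assms(1) Suc assms(2)])
  finally show ?case .
qed

lemma card_of_lists:
  assumes "|A| \<le>o r" and "Cinfinite r"
  shows "|lists A| \<le>o r"
proof -
  have "lists A = (\<Union>n. tuples A n)" by (auto simp: tuples_def lists_eq_set)
  moreover have "|\<Union>n. tuples A n| \<le>o r"
  proof (rule UNION_Cinfinite_bound)
    show "|UNIV :: nat set| \<le>o r"
      by (rule ordIso_ordLeq_trans[OF card_of_nat natLeq_ordLeq_cinfinite[OF assms(2)]])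
    show "\<forall>n\<in>UNIV. |tuples A n| \<le>o r" using card_of_tuples[OF assms] by blast
    show "Cinfinite r" by (rule assms(2))
  qed
  ultimately show ?thesis by simp
qed

lemma card_of_Pow_cexp:
  assumes "|A| \<le>o r" and "Card_order r"
  shows "|Pow A| \<le>o ctwo ^c r"
proof -
  have "|A| \<le>o |Field r|"
    using assms(1) ordIso_symmetric[OF card_of_Field_ordIso[OF assms(2)]]
    by (rule ordLeq_ordIso_trans)
  then obtain f where f: "inj_on f A" "f ` A \<subseteq> Field r" using card_of_ordLeq by metis
  have "|Pow A| \<le>o |Pow (Field r)|"
    by (rule card_of_ordLeqI[where f = "image f"])
      (use f inj_on_image_Pow in \<open>auto simp: image_subset_iff\<close>)
  also have "|Pow (Field r)| =o ctwo ^c r"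
    unfolding ctwo_def cexp_def Field_card_of by (rule card_of_Pow_Func)
  finally show ?thesis .
qed

lemma ctwo_cexp_cexp:
  assumes "Cinfinite r"
  shows "(ctwo ^c r) ^c r =o ctwo ^c r"
proof -
  have "(ctwo ^c r) ^c r =o ctwo ^c (r *c r)"
    by (rule cexp_cprod[OF Card_order_ctwo])
  moreover have "ctwo ^c (r *c r) =o ctwo ^c r"
    using assms cprod_infinite by (intro cexp_cong2) (auto simp: Card_order_ctwo Card_order_cprod)
  ultimately show ?thesis by (rule ordIso_transitive)
qed

text \<open>\<open>ctwo ^c r\<close> is unchanged by raising it to the power \<open>r\<close>. This
  lets a set of that size absorb, for each of its subsets of size at most \<open>r\<close>, up to
  \<open>ctwo ^c r\<close> further points.\<close>

lemma small_subsets_ctwo_cexp: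
  assumes "|X| \<le>o ctwo ^c r" and "Cinfinite r"
  shows "|{U. U \<subseteq> X \<and> U \<noteq> {} \<and> |U| \<le>o r}| \<le>o ctwo ^c r"
proof -
  have "|{U. U \<subseteq> X \<and> U \<noteq> {} \<and> |U| \<le>o r}| \<le>o |X| ^c r"
    using assms(2) by (intro card_of_small_subsets) blast
  also have "|X| ^c r \<le>o (ctwo ^c r) ^c r"
    using assms by (intro cexp_mono1) auto
  also have "(ctwo ^c r) ^c r =o ctwo ^c r" using assms(2) by (rule ctwo_cexp_cexp)
  finally show ?thesis .
qed

lemma finite_ordLeq_Cinfinite:
  assumes "finite A" and "Cinfinite r"
  shows "|A| \<le>o r"
  by (rule ordLess_imp_ordLeq[OF finite_ordLess_infinite])
    (use assms card_order_on_well_order_on in \<open>auto simp: card_of_well_order_on Field_card_of cinfinite_def\<close>)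

lemma Cinfinite_ctwo_cexp: "Cinfinite r \<Longrightarrow> Cinfinite (ctwo ^c r)"
  by (rule Cinfinite_cexp) (simp_all add: ordLeq_refl Card_order_ctwo)

lemma ordLeq_ctwo_cexp: "Card_order r \<Longrightarrow> r \<le>o ctwo ^c r"
  by (rule ordLess_imp_ordLeq[OF ordLess_ctwo_cexp])

section \<open>Structures and automorphisms\<close>

lemma tuples_mono: "A \<subseteq> B \<Longrightarrow> xs \<in> tuples A n \<Longrightarrow> xs \<in> tuples B n"
  by (auto simp: tuples_def)

lemma map_tuples: "xs \<in> tuples A n \<Longrightarrow> map h xs \<in> tuples (h ` A) n"
  by (auto simp: tuples_def)

lemma tuples_imageE:
  assumes "ys \<in> tuples (h ` A) n"
  obtains xs where "xs \<in> tuples A n" and "ys = map h xs"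
proof -
  have "ys \<in> lists (h ` A)" using assms by (auto simp: tuples_def)
  then obtain xs where "xs \<in> lists A" "ys = map h xs" by (auto simp: lists_image)
  then show thesis using assms by (intro that[of xs]) (auto simp: tuples_def)
qed

lemma fint_closed:
  assumes "is_struct \<tau> M" and "f \<in> funs \<tau>" and "xs \<in> tuples (univ M) (farity \<tau> f)"
  shows "fint M f xs \<in> univ M"
  using assms unfolding is_struct_def by metis

lemma fint_undefined:
  assumes "is_struct \<tau> M" and "\<not> (f \<in> funs \<tau> \<and> xs \<in> tuples (univ M) (farity \<tau> f))"
  shows "fint M f xs = undefined"
  using assms unfolding is_struct_def by metis

lemma rint_tuples:
  assumes "is_struct \<tau> M" and "xs \<in> rint M R"
  shows "R \<in> rels \<tau>" and "xs \<in> tuples (univ M) (rarity \<tau> R)"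
proof -
  have "rint M R \<subseteq> (if R \<in> rels \<tau> then tuples (univ M) (rarity \<tau> R) else {})"
    using assms(1) unfolding is_struct_def by blast
  then show "R \<in> rels \<tau>" and "xs \<in> tuples (univ M) (rarity \<tau> R)"
    using assms(2) by (auto split: if_splits)
qed

lemma substruct_is_struct:
  assumes "substruct \<tau> M N"
  shows "is_struct \<tau> M" and "is_struct \<tau> N" and "univ M \<subseteq> univ N"
  using assms by (auto simp: substruct_def)

lemma substruct_common_extension:
  assumes "substruct \<tau> N M" and "substruct \<tau> N' M" and "univ N \<subseteq> univ N'"
  shows "substruct \<tau> N N'"
  using assms tuples_mono[OF assms(3)] unfolding substruct_def by fastforce

text \<open>Inside the common universe both interpretations are read off from \<open>M\<close>;
  outside it \<open>is_struct\<close> prescribes them. Models inside a fixed one can therefore be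
  counted by their universes.\<close>

lemma substruct_eqI:
  assumes "substruct \<tau> N M" and "substruct \<tau> N' M" and "univ N = univ N'"
  shows "N = N'"
proof -
  have "fint N f xs = fint N' f xs" for f xs
  proof (cases "f \<in> funs \<tau> \<and> xs \<in> tuples (univ N) (farity \<tau> f)")
    case True
    then show ?thesis using assms unfolding substruct_def by metis
  next
    case False
    then show ?thesis
      using fint_undefined substruct_is_struct(1)[OF assms(1)] substruct_is_struct(1)[OF assms(2)]
        assms(3) by metis
  qed
  moreover have "xs \<in> rint N R \<longleftrightarrow> xs \<in> rint N' R" for R xs
  proof (cases "R \<in> rels \<tau> \<and> xs \<in> tuples (univ N) (rarity \<tau> R)")
    case True
    then show ?thesis using assms unfolding substruct_def by metis
  next
    case False
    then show ?thesis
      using rint_tuples substruct_is_struct(1)[OF assms(1)] substruct_is_struct(1)[OF assms(2)]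
        assms(3) by metis
  qed
  ultimately show ?thesis using assms(3) by (intro struct.equality) (auto simp: fun_eq_iff)
qed

lemma struct_iso_comp:
  assumes g: "struct_iso \<tau> g M N" and h: "struct_iso \<tau> h N P"
  shows "struct_iso \<tau> (h \<circ> g) M P"
proof -
  have im: "g ` univ M = univ N" using g by (auto simp: struct_iso_def bij_betw_def)
  have t: "map g xs \<in> tuples (univ N) n" if "xs \<in> tuples (univ M) n" for xs n
    using map_tuples[OF that, of g] im by simp
  show ?thesis
    using g h t bij_betw_trans unfolding struct_iso_def by (simp add: map_map[symmetric] del: map_map) blast
qed

lemma struct_iso_inv:
  assumes h: "struct_iso \<tau> h M N"
  shows "struct_iso \<tau> (inv_into (univ M) h) N M"
proof -
  let ?g = "inv_into (univ M) h"
  have bij: "bij_betw h (univ M) (univ N)" using h by (auto simp: struct_iso_def)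
  have im: "univ N = h ` univ M" using bij by (auto simp: bij_betw_def)
  have gh: "?g (h x) = x" if "x \<in> univ M" for x
    using bij that by (auto simp: bij_betw_def)
  have gm: "map ?g (map h xs) = xs" if "xs \<in> tuples (univ M) n" for xs n
    using that gh by (auto simp: tuples_def intro!: map_idI)
  have M: "is_struct \<tau> M" using h by (auto simp: struct_iso_def)
  show ?thesis unfolding struct_iso_def
  proof (intro conjI ballI)
    show "is_struct \<tau> N" "is_struct \<tau> M" using h by (auto simp: struct_iso_def)
    show "bij_betw ?g (univ N) (univ M)" using bij by (rule bij_betw_inv_into)
  next
    fix f ys assume f: "f \<in> funs \<tau>" and "ys \<in> tuples (univ N) (farity \<tau> f)"
    then obtain xs where xs: "xs \<in> tuples (univ M) (farity \<tau> f)" "ys = map h xs"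
      unfolding im by (blast elim: tuples_imageE)
    have "fint M f xs \<in> univ M" by (rule fint_closed[OF M f xs(1)])
    moreover have "fint N f ys = h (fint M f xs)" using h f xs unfolding struct_iso_def by auto
    ultimately show "?g (fint N f ys) = fint M f (map ?g ys)"
      using gm[OF xs(1)] gh xs(2) by simp
  next
    fix R ys assume R: "R \<in> rels \<tau>" and "ys \<in> tuples (univ N) (rarity \<tau> R)"
    then obtain xs where xs: "xs \<in> tuples (univ M) (rarity \<tau> R)" "ys = map h xs"
      unfolding im by (blast elim: tuples_imageE)
    then show "ys \<in> rint N R \<longleftrightarrow> map ?g ys \<in> rint M R"
      using h R gm[OF xs(1)] unfolding struct_iso_def by metis
  qed
qed

lemma struct_iso_id: "is_struct \<tau> M \<Longrightarrow> (\<And>x. x \<in> univ M \<Longrightarrow> h x = x) \<Longrightarrow> struct_iso \<tau> h M M"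
proof -
  assume M: "is_struct \<tau> M" and id: "\<And>x. x \<in> univ M \<Longrightarrow> h x = x"
  have "bij_betw h (univ M) (univ M)" using id by (auto simp: bij_betw_def inj_on_def image_iff)
  moreover have "map h xs = xs" if "xs \<in> tuples (univ M) n" for xs n
    using that id by (auto simp: tuples_def intro!: map_idI)
  moreover have "fint M f xs \<in> univ M" if "f \<in> funs \<tau>" "xs \<in> tuples (univ M) (farity \<tau> f)" for f xs
    by (rule fint_closed[OF M that])
  ultimately show ?thesis using M id unfolding struct_iso_def by simp
qed

definition restr_struct ::
  "('f, 'r) vocabulary \<Rightarrow> ('a, 'f, 'r) struct \<Rightarrow> 'a set \<Rightarrow> ('a, 'f, 'r) struct" where
  "restr_struct \<tau> M U =
     \<lparr>univ = U,
      fint = (\<lambda>f xs. if f \<in> funs \<tau> \<and> xs \<in> tuples U (farity \<tau> f) then fint M f xs else undefined),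
      rint = (\<lambda>R. if R \<in> rels \<tau> then rint M R \<inter> tuples U (rarity \<tau> R) else {})\<rparr>"

lemma substruct_restr_struct:
  assumes "is_struct \<tau> M" and "U \<subseteq> univ M" and "U \<noteq> {}"
    and "\<And>f xs. f \<in> funs \<tau> \<Longrightarrow> xs \<in> tuples U (farity \<tau> f) \<Longrightarrow> fint M f xs \<in> U"
  shows "substruct \<tau> (restr_struct \<tau> M U) M"
  using assms unfolding substruct_def is_struct_def restr_struct_def by auto

section \<open>Automorphisms and maps that agree with them locally\<close>

lemma Aut_iso: "\<sigma> \<in> Aut K C A \<Longrightarrow> struct_iso (voc K) \<sigma> C C"
  by (simp add: Aut_def)

lemma Aut_fixes: "\<sigma> \<in> Aut K C A \<Longrightarrow> a \<in> A \<Longrightarrow> \<sigma> a = a"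
  by (simp add: Aut_def)

lemma Aut_antimono: "\<sigma> \<in> Aut K C B \<Longrightarrow> A \<subseteq> B \<Longrightarrow> \<sigma> \<in> Aut K C A"
  by (auto simp: Aut_def)

lemma Aut_bij: "\<sigma> \<in> Aut K C A \<Longrightarrow> bij_betw \<sigma> (univ C) (univ C)"
  by (simp add: Aut_def struct_iso_def)

lemma Aut_closed: "\<sigma> \<in> Aut K C A \<Longrightarrow> a \<in> univ C \<Longrightarrow> \<sigma> a \<in> univ C"
  using Aut_bij bij_betwE by blast

lemma Aut_comp: "\<sigma> \<in> Aut K C A \<Longrightarrow> \<rho> \<in> Aut K C A \<Longrightarrow> \<sigma> \<circ> \<rho> \<in> Aut K C A"
  using struct_iso_comp by (fastforce simp: Aut_def)

lemma Aut_inv: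
  assumes "\<sigma> \<in> Aut K C A" and "A \<subseteq> univ C"
  shows "inv_into (univ C) \<sigma> \<in> Aut K C A"
proof -
  have "inv_into (univ C) \<sigma> a = a" if "a \<in> A" for a
    using Aut_fixes[OF assms(1) that] Aut_bij[OF assms(1)] that assms(2)
    by (metis bij_betw_inv_into_left subsetD)
  then show ?thesis using struct_iso_inv[OF Aut_iso[OF assms(1)]] by (auto simp: Aut_def)
qed

lemma Aut_inv_apply:
  assumes "\<sigma> \<in> Aut K C A" and "a \<in> univ C"
  shows "inv_into (univ C) \<sigma> (\<sigma> a) = a" and "\<sigma> (inv_into (univ C) \<sigma> a) = a"
  using Aut_bij[OF assms(1)] assms(2)
  by (auto simp: bij_betw_inv_into_left bij_betw_inv_into_right)

text \<open>Arities are finite, so each instance of the isomorphism conditions involves finitely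
  many points, on which \<open>h\<close> agrees with an automorphism. This covers unions of coherent
  maps along a chain.\<close>

lemma struct_iso_of_locally_Aut:
  assumes M: "substruct (voc K) M C" and N: "substruct (voc K) N C"
    and bij: "bij_betw h (univ M) (univ N)"
    and loc: "\<And>F. finite F \<Longrightarrow> F \<subseteq> univ M \<Longrightarrow> \<exists>\<sigma>\<in>Aut K C {}. \<forall>x\<in>F. \<sigma> x = h x"
  shows "struct_iso (voc K) h M N"
  unfolding struct_iso_def
proof (intro conjI ballI)
  show "is_struct (voc K) M" "is_struct (voc K) N" using M N by (auto simp: substruct_def)
  show "bij_betw h (univ M) (univ N)" by (rule bij)
  have im: "h ` univ M = univ N" using bij by (auto simp: bij_betw_def)
  have MC: "univ M \<subseteq> univ C" using M by (auto simp: substruct_def)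
  {
    fix f xs assume f: "f \<in> funs (voc K)" and xs: "xs \<in> tuples (univ M) (farity (voc K) f)"
    have y: "fint M f xs \<in> univ M" by (rule fint_closed[OF substruct_is_struct(1)[OF M] f xs])
    have "set xs \<subseteq> univ M" using xs by (auto simp: tuples_def)
    \<comment> \<open>The function value joins the arguments, since \<open>\<sigma>\<close> must
      agree with \<open>h\<close> there too.\<close>
    then obtain \<sigma> where \<sigma>: "\<sigma> \<in> Aut K C {}" "\<forall>x\<in>insert (fint M f xs) (set xs). \<sigma> x = h x"
      using loc[of "insert (fint M f xs) (set xs)"] y by auto
    have hx: "map \<sigma> xs = map h xs" using \<sigma>(2) by simp
    have "h (fint M f xs) = \<sigma> (fint C f xs)"
      using \<sigma>(2) M f xs unfolding substruct_def by (metis insertI1)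
    also have "\<dots> = fint C f (map \<sigma> xs)"
      using Aut_iso[OF \<sigma>(1)] f tuples_mono[OF MC xs] unfolding struct_iso_def by blast
    also have "\<dots> = fint N f (map h xs)"
      using N f map_tuples[OF xs, of h] unfolding hx im substruct_def by metis
    finally show "h (fint M f xs) = fint N f (map h xs)" .
  next
    fix R xs assume R: "R \<in> rels (voc K)" and xs: "xs \<in> tuples (univ M) (rarity (voc K) R)"
    have "set xs \<subseteq> univ M" using xs by (auto simp: tuples_def)
    then obtain \<sigma> where \<sigma>: "\<sigma> \<in> Aut K C {}" "\<forall>x\<in>set xs. \<sigma> x = h x"
      using loc[of "set xs"] by auto
    have hx: "map \<sigma> xs = map h xs" using \<sigma>(2) by simp
    have "xs \<in> rint M R \<longleftrightarrow> xs \<in> rint C R"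
      using M R xs unfolding substruct_def by metis
    also have "\<dots> \<longleftrightarrow> map \<sigma> xs \<in> rint C R"
      using Aut_iso[OF \<sigma>(1)] R tuples_mono[OF MC xs] unfolding struct_iso_def by blast
    also have "\<dots> \<longleftrightarrow> map h xs \<in> rint N R"
      using N R map_tuples[OF xs, of h] unfolding hx im substruct_def by metis
    finally show "xs \<in> rint M R \<longleftrightarrow> map h xs \<in> rint N R" .
  }
qed

section \<open>Models inside the monster model\<close>

text \<open>Cardinals are well-ordered, so the choice in \<open>LS\<close> picks an actual
  bound.\<close>

lemma LST_bound_LS:
  assumes "aec K"
  shows "LST_bound K (LS K)"
proof -
  let ?R = "{\<mu>. LST_bound K \<mu>}"
  have "\<exists>\<mu>. LST_bound K \<mu>" using assms unfolding aec_def by (elim conjE)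
  then have "?R \<noteq> {}" by blast
  moreover have "\<forall>r\<in>?R. Well_order r"
    using card_order_on_well_order_on unfolding LST_bound_def by blast
  ultimately have "\<exists>\<mu>. LST_bound K \<mu> \<and> (\<forall>\<mu>'. LST_bound K \<mu>' \<longrightarrow> \<mu> \<le>o \<mu>')"
    using exists_minim_Well_order[of ?R] by blast
  then show ?thesis unfolding LS_def by (rule someI2_ex) blast
qed

text \<open>It reduces counting types to counting codes that determine them.\<close>

lemma card_of_image_factor:
  assumes "\<And>a b. a \<in> S \<Longrightarrow> b \<in> S \<Longrightarrow> g a = g b \<Longrightarrow> f a = f b"
  shows "|f ` S| \<le>o |g ` S|"
proof (rule surj_imp_ordLeq)
  show "f ` S \<subseteq> (\<lambda>y. f (inv_into S g y)) ` (g ` S)"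
  proof
    fix z assume "z \<in> f ` S"
    then obtain a where a: "a \<in> S" "z = f a" by blast
    have "f (inv_into S g (g a)) = f a"
      using a(1) by (intro assms) (auto intro: inv_into_into f_inv_into_f)
    then show "z \<in> (\<lambda>y. f (inv_into S g y)) ` (g ` S)" using a by force
  qed
qed

section \<open>Consequences of the AEC axioms\<close>

locale monster_class =
  fixes K :: "('a, 'f, 'r) aclass" and C :: "('a, 'f, 'r) struct"
  assumes aec: "aec K" and monster: "monster K C"
begin

lemma C_model: "C \<in> models K"
  using monster unfolding monster_def by blast

lemma aec_axioms:
  shows "\<forall>M N. strong K M N \<longrightarrow> M \<in> models K \<and> N \<in> models K \<and> substruct (voc K) M N"
    and "\<forall>M N P. strong K M N \<and> strong K N P \<longrightarrow> strong K M P"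
    and "\<forall>M N M' N' h. strong K M N \<and> struct_iso (voc K) h N N' \<and> struct_iso (voc K) h M M' \<and>
      substruct (voc K) M' N' \<longrightarrow> strong K M' N'"
    and "\<forall>M0 M1 M2. strong K M0 M2 \<and> strong K M1 M2 \<and> substruct (voc K) M0 M1 \<longrightarrow> strong K M0 M1"
    and "\<forall>r \<M>. increasing_chain K r \<M> \<longrightarrow>
      union_struct (voc K) (\<M> ` Field r) \<in> models K \<and>
      (\<forall>i\<in>Field r. strong K (\<M> i) (union_struct (voc K) (\<M> ` Field r))) \<and>
      (\<forall>N. (\<forall>i\<in>Field r. strong K (\<M> i) N) \<longrightarrow> strong K (union_struct (voc K) (\<M> ` Field r)) N)"
    and "\<forall>M\<in>models K. is_struct (voc K) M"
  using aec unfolding aec_def by - (elim conjE; assumption)+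

lemma model_is_struct: "M \<in> models K \<Longrightarrow> is_struct (voc K) M"
  using aec_axioms(6) by blast

lemma strongD:
  assumes "strong K M N"
  shows "M \<in> models K" and "N \<in> models K" and "substruct (voc K) M N"
  using aec_axioms(1) assms by blast+

lemma strong_univ: "strong K M N \<Longrightarrow> univ M \<subseteq> univ N"
  using strongD(3) unfolding substruct_def by blast

lemma strong_univ_nonempty: "strong K M N \<Longrightarrow> univ M \<noteq> {}"
  using strongD(1) model_is_struct unfolding is_struct_def by blast

lemma strong_trans: "strong K M N \<Longrightarrow> strong K N P \<Longrightarrow> strong K M P"
  using aec_axioms(2) by blast

text \<open>A common strong extension already makes the smaller model a substructure of the larger,
  so the coherence axiom asks only for nested universes.\<close>

lemma coherence:
  assumes "strong K M0 M" and "strong K M1 M" and "univ M0 \<subseteq> univ M1"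
  shows "strong K M0 M1"
proof -
  have "substruct (voc K) M0 M1"
    using substruct_common_extension[OF strongD(3)[OF assms(1)] strongD(3)[OF assms(2)] assms(3)] .
  then show ?thesis using aec_axioms(4) assms by blast
qed

lemma strong_univ_inject:
  assumes "strong K M0 M" and "strong K M1 M" and "univ M0 = univ M1"
  shows "M0 = M1"
  using substruct_eqI[OF strongD(3)[OF assms(1)] strongD(3)[OF assms(2)] assms(3)] .

lemma Cinfinite_if_LS_le:
  assumes "LS K \<le>o r" and "Card_order r"
  shows "Cinfinite r"
proof -
  have "natLeq \<le>o LS K" using LST_bound_LS[OF aec] unfolding LST_bound_def by blast
  then have "natLeq \<le>o r" using assms(1) by (rule ordLeq_transitive)
  then show ?thesis using assms(2) natLeq_cinfinite cinfinite_mono by blast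
qed

lemma obtain_submodel:
  assumes "M \<in> models K" and "A \<subseteq> univ M" and "|A| \<le>o r" and "Card_order r" and "LS K \<le>o r"
  obtains N where "strong K N M" and "A \<subseteq> univ N" and "|univ N| \<le>o r"
proof -
  obtain N where N: "strong K N M" "A \<subseteq> univ N" "|univ N| \<le>o |A| +c LS K"
    using LST_bound_LS[OF aec] assms(1,2) unfolding LST_bound_def by blast
  have "|A| +c LS K \<le>o r"
    using csum_cinfinite_bound[OF assms(3,5) card_of_Card_order _ Cinfinite_if_LS_le[OF assms(5,4)]]
      LST_bound_LS[OF aec] unfolding LST_bound_def by blast
  with N(3) have "|univ N| \<le>o r" by (rule ordLeq_transitive)
  with N(1,2) show thesis by (rule that)
qed

text \<open>The axioms speak of chains indexed by well-orders on the type of the elements, so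
  \<open>s\<close> is carried there by \<open>f\<close>. Coherence inside \<open>P\<close> turns
  nested universes into a chain.\<close>

lemma chain_union:
  fixes s :: "'c rel" and f :: "'c \<Rightarrow> 'a"
  assumes s: "Well_order s" and inj: "inj_on f (Field s)" and ne: "Field s \<noteq> {}"
    and lim: "\<forall>i\<in>Field s. \<exists>j. (i, j) \<in> s \<and> j \<noteq> i"
    and D: "\<forall>i\<in>Field s. strong K (D i) P"
    and mono: "\<And>i j. (i, j) \<in> s \<Longrightarrow> univ (D i) \<subseteq> univ (D j)"
  obtains U where "strong K U P" and "univ U = (\<Union>i\<in>Field s. univ (D i))"
proof -
  let ?r = "dir_image s f" and ?E = "D \<circ> inv_into (Field s) f"
  have F: "Field ?r = f ` Field s" by (simp add: dir_image_Field)
  have E: "?E (f i) = D i" if "i \<in> Field s" for i using that inj by simp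
  have "increasing_chain K ?r ?E"
    unfolding increasing_chain_def
  proof (intro conjI allI impI ballI)
    show "Well_order ?r" using s inj by (rule Well_order_dir_image)
    show "Field ?r \<noteq> {}" using ne F by simp
  next
    fix x assume "x \<in> Field ?r"
    then obtain i where i: "i \<in> Field s" "x = f i" unfolding F by blast
    then obtain j where j: "(i, j) \<in> s" "j \<noteq> i" using lim by blast
    then have "j \<in> Field s" by (auto simp: Field_def)
    then have "f j \<noteq> f i" using inj i(1) j(2) by (auto dest: inj_onD)
    then show "\<exists>y. (x, y) \<in> ?r \<and> y \<noteq> x" using i(2) j(1) by (auto simp: dir_image_def)
    show "?E x \<in> models K" unfolding i(2) E[OF i(1)] using D i(1) strongD(1) by blast
  next
    fix x y assume "(x, y) \<in> ?r"
    then obtain i j where ij: "(i, j) \<in> s" "x = f i" "y = f j" by (auto simp: dir_image_def)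
    then have F: "i \<in> Field s" "j \<in> Field s" by (auto simp: Field_def)
    show "strong K (?E x) (?E y)" unfolding ij(2,3) E[OF F(1)] E[OF F(2)]
      using D F mono[OF ij(1)] by (blast intro: coherence)
  qed
  moreover have "\<forall>x\<in>Field ?r. strong K (?E x) P" unfolding F using D E by simp
  ultimately have "strong K (union_struct (voc K) (?E ` Field ?r)) P"
    using aec_axioms(5) by blast
  moreover have "univ (union_struct (voc K) (?E ` Field ?r)) = (\<Union>i\<in>Field s. univ (D i))"
    unfolding F union_struct_def using E by simp
  ultimately show thesis by (rule that)
qed

text \<open>The image is realized as a substructure of \<open>C\<close>. Closure of the strong
  relation under isomorphism, applied to the pair \<open>N\<close>, \<open>C\<close> and to
  \<open>\<sigma>\<close>, makes it strong in \<open>C\<close>.\<close>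

lemma image_model:
  assumes \<sigma>: "\<sigma> \<in> Aut K C {}" and N: "strong K N C"
  obtains N' where "strong K N' C" and "univ N' = \<sigma> ` univ N" and "struct_iso (voc K) \<sigma> N N'"
proof -
  let ?N' = "restr_struct (voc K) C (\<sigma> ` univ N)"
  have u: "univ ?N' = \<sigma> ` univ N" by (simp add: restr_struct_def)
  have NC: "substruct (voc K) N C" using N by (rule strongD)
  have inj: "inj_on \<sigma> (univ C)" using Aut_bij[OF \<sigma>] by (auto simp: bij_betw_def)
  have sub: "substruct (voc K) ?N' C"
  proof (rule substruct_restr_struct)
    show "is_struct (voc K) C" using C_model by (rule model_is_struct)
    show "\<sigma> ` univ N \<subseteq> univ C" using strong_univ[OF N] Aut_closed[OF \<sigma>] by blast
    show "\<sigma> ` univ N \<noteq> {}" using strong_univ_nonempty[OF N] by blast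
    fix f ys assume f: "f \<in> funs (voc K)" and "ys \<in> tuples (\<sigma> ` univ N) (farity (voc K) f)"
    then obtain xs where xs: "xs \<in> tuples (univ N) (farity (voc K) f)" "ys = map \<sigma> xs"
      by (blast elim: tuples_imageE)
    have "fint C f ys = \<sigma> (fint C f xs)"
      using Aut_iso[OF \<sigma>] f tuples_mono[OF strong_univ[OF N] xs(1)] xs(2)
      unfolding struct_iso_def by simp
    also have "\<dots> = \<sigma> (fint N f xs)" using NC f xs(1) unfolding substruct_def by simp
    finally show "fint C f ys \<in> \<sigma> ` univ N"
      using fint_closed[OF substruct_is_struct(1)[OF NC] f xs(1)] by simp
  qed
  have iso: "struct_iso (voc K) \<sigma> N ?N'"
  proof (rule struct_iso_of_locally_Aut[OF NC sub])
    show "bij_betw \<sigma> (univ N) (univ ?N')"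
      unfolding u using inj_on_subset[OF inj strong_univ[OF N]] by (rule inj_on_imp_bij_betw)
  qed (use \<sigma> in blast)
  have "strong K ?N' C" using aec_axioms(3) N Aut_iso[OF \<sigma>] iso sub by blast
  then show thesis using u iso by (rule that)
qed

lemma homogeneity:
  assumes "small_model K C M" and "small_model K C N" and "struct_iso (voc K) h M N"
  obtains \<sigma> where "\<sigma> \<in> Aut K C {}" and "\<forall>x\<in>univ M. \<sigma> x = h x"
  using monster assms unfolding monster_def by blast

section \<open>Galois types of elements\<close>

lemma Aut_id: "id \<in> Aut K C A"
  using struct_iso_id[OF model_is_struct[OF C_model], of id] by (simp add: Aut_def)

lemma gtp1I: "\<sigma> \<in> Aut K C A \<Longrightarrow> \<sigma> a \<in> gtp1 K C a A"
  by (auto simp: gtp1_def)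

lemma gtp1_self: "a \<in> gtp1 K C a A"
  using gtp1I[OF Aut_id] by simp

lemma gtp1E:
  assumes "b \<in> gtp1 K C a A"
  obtains \<sigma> where "\<sigma> \<in> Aut K C A" and "b = \<sigma> a"
  using assms unfolding gtp1_def by blast

lemma gtp1_antimono:
  assumes "b \<in> gtp1 K C a B" and "A \<subseteq> B"
  shows "b \<in> gtp1 K C a A"
proof -
  obtain \<sigma> where \<sigma>: "\<sigma> \<in> Aut K C B" "b = \<sigma> a" using assms(1) by (rule gtp1E)
  show ?thesis unfolding \<sigma>(2) by (rule gtp1I[OF Aut_antimono[OF \<sigma>(1) assms(2)]])
qed

lemma gtp1_closed:
  assumes "b \<in> gtp1 K C a A" and "a \<in> univ C"
  shows "b \<in> univ C"
proof -
  obtain \<sigma> where \<sigma>: "\<sigma> \<in> Aut K C A" "b = \<sigma> a" using assms(1) by (rule gtp1E)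
  show ?thesis unfolding \<sigma>(2) by (rule Aut_closed[OF \<sigma>(1) assms(2)])
qed

lemma gtp1_trans:
  assumes "b \<in> gtp1 K C a A" and "c \<in> gtp1 K C b A"
  shows "c \<in> gtp1 K C a A"
proof -
  obtain \<sigma> where \<sigma>: "\<sigma> \<in> Aut K C A" "b = \<sigma> a" using assms(1) by (rule gtp1E)
  obtain \<rho> where \<rho>: "\<rho> \<in> Aut K C A" "c = \<rho> b" using assms(2) by (rule gtp1E)
  show ?thesis using gtp1I[OF Aut_comp[OF \<rho>(1) \<sigma>(1)], of a] \<sigma>(2) \<rho>(2) by simp
qed

lemma gtp1_sym:
  assumes "b \<in> gtp1 K C a A" and "A \<subseteq> univ C" and "a \<in> univ C"
  shows "a \<in> gtp1 K C b A"
proof -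
  obtain \<sigma> where \<sigma>: "\<sigma> \<in> Aut K C A" "b = \<sigma> a" using assms(1) by (rule gtp1E)
  show ?thesis using gtp1I[OF Aut_inv[OF \<sigma>(1) assms(2)], of b] Aut_inv_apply(1)[OF \<sigma>(1) assms(3)]
    unfolding \<sigma>(2) by simp
qed

lemma gtp1_eqI:
  assumes "b \<in> gtp1 K C a A" and "A \<subseteq> univ C" and "a \<in> univ C"
  shows "gtp1 K C b A = gtp1 K C a A"
  using gtp1_trans[OF assms(1)] gtp1_trans[OF gtp1_sym[OF assms]] by blast

text \<open>Homogeneity extends \<open>h\<close> to an automorphism, which fixes \<open>A\<close>
  because \<open>h\<close> does.\<close>

lemma gtp1_if_iso:
  assumes "small_model K C M" and "small_model K C N" and "struct_iso (voc K) h M N"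
    and "A \<subseteq> univ M" and "a \<in> univ M" and "\<And>x. x \<in> A \<Longrightarrow> h x = x"
  shows "h a \<in> gtp1 K C a A"
proof -
  obtain \<sigma> where \<sigma>: "\<sigma> \<in> Aut K C {}" "\<forall>x\<in>univ M. \<sigma> x = h x"
    using assms(1-3) by (rule homogeneity)
  have "\<sigma> \<in> Aut K C A" using \<sigma> assms(4,6) by (auto simp: Aut_def)
  then show ?thesis using gtp1I[of \<sigma> A a] \<sigma>(2) assms(5) by simp
qed

text \<open>By homogeneity, the type of \<open>a\<close> is determined by the isomorphism type over
  \<open>A\<close> of a model of size at most \<open>r\<close> that contains \<open>A\<close> and
  \<open>a\<close>, with \<open>a\<close> named. There are at most \<open>ctwo ^c r\<close> such
  isomorphism types.\<close>

lemma card_of_gtp1: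
  assumes r: "Card_order r" and LS: "LS K \<le>o r" and rC: "r <o |univ C|"
    and A: "A \<subseteq> univ C" "|A| \<le>o r"
  shows "|(\<lambda>a. gtp1 K C a A) ` univ C| \<le>o ctwo ^c r"
proof -
  have inf: "Cinfinite r" using LS r by (rule Cinfinite_if_LS_le)
  have "\<exists>N e. strong K N C \<and> insert a A \<subseteq> univ N \<and> |univ N| \<le>o r \<and> e ` Field r = univ N"
    if a: "a \<in> univ C" for a
  proof -
    have "|insert a A| \<le>o r"
      using Un_Cinfinite_bound[of "{a}" r A] Card_order_singl_ordLeq[OF r, of a] inf A(2)
      by (metis cinfinite_def finite.emptyI insert_is_Un)
    then obtain N where N: "strong K N C" "insert a A \<subseteq> univ N" "|univ N| \<le>o r"
      using obtain_submodel[OF C_model, of "insert a A" r] a A(1) r LS by blast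
    have "|univ N| \<le>o |Field r|"
      using N(3) ordIso_symmetric[OF card_of_Field_ordIso[OF r]] by (rule ordLeq_ordIso_trans)
    then obtain e where "e ` Field r = univ N"
      using strong_univ_nonempty[OF N(1)] by (rule card_of_le_imp_surj)
    with N show ?thesis by blast
  qed
  then obtain N e where Ne: "\<And>a. a \<in> univ C \<Longrightarrow> strong K (N a) C \<and> insert a A \<subseteq> univ (N a) \<and>
      |univ (N a)| \<le>o r \<and> e a ` Field r = univ (N a)"
    by metis
  let ?F = "Field r"
  \<comment> \<open>The code of \<open>a\<close> is the structure \<open>N a\<close> with names for \<open>a\<close> and the members of \<open>A\<close>, pulled back
    along the enumeration \<open>e a\<close>.\<close>
  define c1 where "c1 a = {i\<in>?F. e a i = a}" for a
  define c2 where "c2 a = {(i, x). i \<in> ?F \<and> x \<in> A \<and> e a i = x}" for a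
  \<comment> \<open>An enumeration may repeat elements, so the code records equality of values; this
    makes \<open>h\<close> below well defined and injective.\<close>
  define c3 where "c3 a = {(i, j). i \<in> ?F \<and> j \<in> ?F \<and> e a i = e a j}" for a
  define c4 where "c4 a = {(f, is, j). f \<in> funs (voc K) \<and> is \<in> lists ?F \<and> j \<in> ?F \<and>
      fint (N a) f (map (e a) is) = e a j}" for a
  define c5 where "c5 a = {(R, is). R \<in> rels (voc K) \<and> is \<in> lists ?F \<and>
      map (e a) is \<in> rint (N a) R}" for a
  define code where "code a = (c1 a, c2 a, c3 a, c4 a, c5 a)" for a
  have "|(\<lambda>a. gtp1 K C a A) ` univ C| \<le>o |code ` univ C|"
  proof (rule card_of_image_factor)
    fix a b assume a: "a \<in> univ C" and b: "b \<in> univ C" and "code a = code b"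
    then have eq: "c1 a = c1 b" "c2 a = c2 b" "c3 a = c3 b" "c4 a = c4 b" "c5 a = c5 b"
      by (auto simp: code_def)
    have Na: "strong K (N a) C" "insert a A \<subseteq> univ (N a)" "|univ (N a)| \<le>o r" "e a ` ?F = univ (N a)"
      using Ne[OF a] by auto
    have Nb: "strong K (N b) C" "|univ (N b)| \<le>o r" "e b ` ?F = univ (N b)"
      using Ne[OF b] by auto
    have sa: "is_struct (voc K) (N a)" by (rule model_is_struct[OF strongD(1)[OF Na(1)]])
    have sb: "is_struct (voc K) (N b)" by (rule model_is_struct[OF strongD(1)[OF Nb(1)]])
    define h where "h x = e b (inv_into ?F (e a) x)" for x
    have e3: "e a i = e a j \<longleftrightarrow> e b i = e b j" if "i \<in> ?F" "j \<in> ?F" for i j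
      using eq(3) that unfolding c3_def set_eq_iff by auto
    have h: "h (e a i) = e b i" if i: "i \<in> ?F" for i
    proof -
      have "e a (inv_into ?F (e a) (e a i)) = e a i" "inv_into ?F (e a) (e a i) \<in> ?F"
        using i by (auto intro: f_inv_into_f inv_into_into)
      then show ?thesis unfolding h_def using e3 i by blast
    qed
    have hm: "map h (map (e a) is) = map (e b) is" if "is \<in> lists ?F" for "is"
      using that h by (induction "is") auto
    have tup: "\<exists>is\<in>lists ?F. xs = map (e a) is" if "xs \<in> tuples (univ (N a)) n" for xs n
    proof -
      have "xs \<in> tuples (e a ` ?F) n" using that unfolding Na(4) .
      then show ?thesis by (rule tuples_imageE) (auto simp: tuples_def)
    qed
    have iso: "struct_iso (voc K) h (N a) (N b)"
      unfolding struct_iso_def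
    proof (intro conjI ballI)
      show "is_struct (voc K) (N a)" "is_struct (voc K) (N b)"
        by (fact sa sb)+
      show "bij_betw h (univ (N a)) (univ (N b))"
        unfolding bij_betw_def
      proof
        have "inj_on h (e a ` ?F)" by (rule inj_onI) (use h e3 in auto)
        then show "inj_on h (univ (N a))" unfolding Na(4) .
        have "h ` (e a ` ?F) = e b ` ?F" using h by force
        then show "h ` univ (N a) = univ (N b)" unfolding Na(4) Nb(3) .
      qed
    next
      fix f xs assume f: "f \<in> funs (voc K)" and xs: "xs \<in> tuples (univ (N a)) (farity (voc K) f)"
      obtain "is" where "is": "is \<in> lists ?F" "xs = map (e a) is" using tup[OF xs] by blast
      have "fint (N a) f xs \<in> univ (N a)"
        by (rule fint_closed[OF sa f xs])
      then have "fint (N a) f xs \<in> e a ` ?F" unfolding Na(4) .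
      then obtain j where j: "j \<in> ?F" "fint (N a) f xs = e a j" by blast
      then have "(f, is, j) \<in> c4 a" using f "is" by (simp add: c4_def)
      then have "fint (N b) f (map (e b) is) = e b j" unfolding eq by (simp add: c4_def)
      then show "h (fint (N a) f xs) = fint (N b) f (map h xs)"
        unfolding "is"(2) hm[OF "is"(1)] using h[OF j(1)] j(2) "is"(2) by simp
    next
      fix R xs assume R: "R \<in> rels (voc K)" and xs: "xs \<in> tuples (univ (N a)) (rarity (voc K) R)"
      obtain "is" where "is": "is \<in> lists ?F" "xs = map (e a) is" using tup[OF xs] by blast
      have "(R, is) \<in> c5 a \<longleftrightarrow> (R, is) \<in> c5 b" using eq by simp
      then show "xs \<in> rint (N a) R \<longleftrightarrow> map h xs \<in> rint (N b) R"
        unfolding "is"(2) hm[OF "is"(1)] using R "is"(1) by (simp add: c5_def)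
    qed
    have ha: "h a = b"
    proof -
      have "a \<in> e a ` ?F" using Na(2,4) by blast
      then obtain i where i: "i \<in> ?F" "e a i = a" by force
      then have "i \<in> c1 b" using eq(1) by (auto simp: c1_def)
      then show ?thesis using h[OF i(1)] i(2) by (simp add: c1_def)
    qed
    have hA: "h x = x" if x: "x \<in> A" for x
    proof -
      have "x \<in> e a ` ?F" using Na(2,4) x by blast
      then obtain i where i: "i \<in> ?F" "e a i = x" by force
      then have "(i, x) \<in> c2 b" using eq(2) x by (auto simp: c2_def)
      then show ?thesis using h[OF i(1)] i(2) by (simp add: c2_def)
    qed
    have "small_model K C (N a)" "small_model K C (N b)"
      using Na(1) Nb(1) ordLeq_ordLess_trans[OF Na(3) rC] ordLeq_ordLess_trans[OF Nb(2) rC]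
      unfolding small_model_def by auto
    then have "h a \<in> gtp1 K C a A"
      using iso by (rule gtp1_if_iso) (use Na(2) hA in auto)
    then show "gtp1 K C a A = gtp1 K C b A" using gtp1_eqI[OF _ A(1) a, of b] unfolding ha by simp
  qed
  also have "|code ` univ C| \<le>o ctwo ^c r"
  proof -
    let ?X = "Pow ?F \<times> Pow (?F \<times> A) \<times> Pow (?F \<times> ?F) \<times>
      Pow (funs (voc K) \<times> lists ?F \<times> ?F) \<times> Pow (rels (voc K) \<times> lists ?F)"
    have F: "|?F| \<le>o r" using card_of_Field_ordIso[OF r] by (rule ordIso_imp_ordLeq)
    have L: "|lists ?F| \<le>o r" using F inf by (rule card_of_lists)
    have V: "|funs (voc K)| +c |rels (voc K)| \<le>o r"
      using LST_bound_LS[OF aec] ordLeq_transitive[OF _ LS] unfolding LST_bound_def by blast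
    have fn: "|funs (voc K)| \<le>o r" and rl: "|rels (voc K)| \<le>o r"
      using ordLeq_transitive[OF ordLeq_csum1 V] ordLeq_transitive[OF ordLeq_csum2 V]
        card_of_Card_order by blast+
    have inf2: "Cinfinite (ctwo ^c r)" using inf by (rule Cinfinite_ctwo_cexp)
    have X: "|?X| \<le>o ctwo ^c r"
      by (intro card_of_Times_Cinfinite_bound card_of_Pow_cexp F L fn rl A(2) r inf inf2)
    have "code ` univ C \<subseteq> ?X"
      by (auto simp: code_def c1_def c2_def c3_def c4_def c5_def)
    then show ?thesis by (rule ordLeq_transitive[OF card_of_mono1 X])
  qed
  finally show ?thesis .
qed

section \<open>Limits of types along chains of length omega\<close>

lemma infinite_UNIV_if_aec: "infinite (UNIV :: 'a set)"
proof -
  have "natLeq \<le>o LS K" using LST_bound_LS[OF aec] unfolding LST_bound_def by blast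
  then have "cinfinite (LS K)" using natLeq_cinfinite by (rule cinfinite_mono)
  then show ?thesis unfolding cinfinite_def by (rule infinite_super[OF subset_UNIV])
qed

lemma omega_chain_union:
  fixes D :: "nat \<Rightarrow> ('a, 'f, 'r) struct"
  assumes D: "\<And>n. strong K (D n) P" and mono: "\<And>n. univ (D n) \<subseteq> univ (D (Suc n))"
  obtains U where "strong K U P" and "univ U = (\<Union>n. univ (D n))"
proof -
  obtain f :: "nat \<Rightarrow> 'a" where f: "inj f"
    using infinite_UNIV_if_aec unfolding infinite_iff_countable_subset by (elim exE conjE)
  have le: "(i, j) \<in> natLeq \<longleftrightarrow> i \<le> j" for i j by (simp add: natLeq_def)
  obtain U where "strong K U P" "univ U = (\<Union>n\<in>Field natLeq. univ (D n))"
  proof (rule chain_union[OF natLeq_Well_order])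
    show "inj_on f (Field natLeq)" using f by (simp add: Field_natLeq)
    show "Field natLeq \<noteq> {}" by (simp add: Field_natLeq)
    show "\<forall>i\<in>Field natLeq. \<exists>j. (i, j) \<in> natLeq \<and> j \<noteq> i"
    proof
      fix i :: nat
      show "\<exists>j. (i, j) \<in> natLeq \<and> j \<noteq> i" unfolding le by (rule exI[of _ "Suc i"]) simp
    qed
    show "\<forall>i\<in>Field natLeq. strong K (D i) P" by (simp add: D)
    show "univ (D i) \<subseteq> univ (D j)" if "(i, j) \<in> natLeq" for i j
      using mono that unfolding le by (rule lift_Suc_mono_le)
  qed
  then show thesis by (intro that) (auto simp: Field_natLeq)
qed

lemma omega_type_limit:
  assumes P: "small_model K C P" and A: "\<And>n :: nat. strong K (A n) P"
    and mono: "\<And>n. univ (A n) \<subseteq> univ (A (Suc n))"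
    and b0: "b 0 \<in> univ C" and b: "\<And>n. b (Suc n) \<in> gtp1 K C (b n) (univ (A n))"
  obtains a where "a \<in> univ C" and "\<And>n. a \<in> gtp1 K C (b n) (univ (A n))"
proof -
  have PC: "strong K P C" using P by (simp add: small_model_def)
  have AC: "strong K (A n) C" for n using A PC by (rule strong_trans)
  have AuC: "univ (A n) \<subseteq> univ C" for n using AC by (rule strong_univ)
  have Amono: "univ (A n) \<subseteq> univ (A m)" if "n \<le> m" for n m
    using mono that by (rule lift_Suc_mono_le)
  have bC: "b n \<in> univ C" for n by (induction n) (use b0 b gtp1_closed in auto)
  have "\<exists>\<sigma>. \<forall>n. \<sigma> n \<in> Aut K C (univ (A n)) \<and> b (Suc n) = \<sigma> n (b n)"
    by (intro choice allI) (use b in \<open>auto elim!: gtp1E\<close>)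
  then obtain \<sigma> where \<sigma>: "\<And>n. \<sigma> n \<in> Aut K C (univ (A n))" "\<And>n. b (Suc n) = \<sigma> n (b n)"
    by blast
  \<comment> \<open>\<open>\<tau> n\<close> moves \<open>b n\<close> back to \<open>b 0\<close>, and the restrictions of \<open>\<tau> n\<close> to \<open>A n\<close> cohere, so their union
    extends to an automorphism whose inverse takes \<open>b 0\<close> to the required element.\<close>
  define \<tau> where "\<tau> = rec_nat id (\<lambda>n t. t \<circ> inv_into (univ C) (\<sigma> n))"
  have \<tau>0: "\<tau> 0 = id" and \<tau>S: "\<tau> (Suc n) = \<tau> n \<circ> inv_into (univ C) (\<sigma> n)" for n
    by (simp_all add: \<tau>_def)
  have \<sigma>i: "inv_into (univ C) (\<sigma> n) \<in> Aut K C (univ (A n))" for n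
    using \<sigma>(1) AuC by (rule Aut_inv)
  have \<tau>: "\<tau> n \<in> Aut K C {}" for n
  proof (induction n)
    case 0
    show ?case unfolding \<tau>0 by (rule Aut_id)
  next
    case (Suc n)
    show ?case unfolding \<tau>S using Suc Aut_antimono[OF \<sigma>i empty_subsetI] by (rule Aut_comp)
  qed
  have \<tau>b: "\<tau> n (b n) = b 0" for n
    by (induction n) (simp_all add: \<tau>0 \<tau>S \<sigma>(2) Aut_inv_apply(1)[OF \<sigma>(1) bC])
  \<comment> \<open>Passing from a stage \<open>m\<close> to its successor composes with a map
    fixing \<open>A m\<close>, which contains \<open>A n\<close>.\<close>
  have \<tau>A: "\<tau> m x = \<tau> n x" if "n \<le> m" "x \<in> univ (A n)" for n m x
    using that(1)
  proof (induction m rule: dec_induct)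
    case (step m)
    have "x \<in> univ (A m)" using Amono[OF step(1)] that(2) by blast
    then show ?case using step(3) Aut_fixes[OF \<sigma>i] by (simp add: \<tau>S)
  qed simp
  define h where "h x = \<tau> (LEAST n. x \<in> univ (A n)) x" for x
  have h: "h x = \<tau> n x" if "x \<in> univ (A n)" for x n
    unfolding h_def using \<tau>A[OF Least_le[of "\<lambda>n. x \<in> univ (A n)", OF that]]
      LeastI[of "\<lambda>n. x \<in> univ (A n)", OF that] by simp
  \<comment> \<open>Every finite subset of the union lies in one stage, where \<open>h\<close> is
    the restriction of an automorphism. This is what the local criterion for isomorphisms asks
    for.\<close>
  have fin: "\<exists>n. F \<subseteq> univ (A n)" if "finite F" "F \<subseteq> (\<Union>n. univ (A n))" for F
    using that
  proof (induction F)
    case (insert x F)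
    then obtain n m where nm: "F \<subseteq> univ (A n)" "x \<in> univ (A m)" by auto
    then have "insert x F \<subseteq> univ (A (max n m))"
      using Amono[of n "max n m"] Amono[of m "max n m"] by auto
    then show ?case ..
  qed simp
  obtain U where U: "strong K U P" "univ U = (\<Union>n. univ (A n))"
    using A mono by (rule omega_chain_union)
  have "\<exists>N'. strong K N' C \<and> univ N' = \<tau> n ` univ (A n)" for n
    by (rule image_model[OF \<tau>[of n] AC[of n]]) blast
  then obtain A' where A': "\<And>n. strong K (A' n) C" "\<And>n. univ (A' n) = \<tau> n ` univ (A n)"
    by metis
  have A'h: "univ (A' n) = h ` univ (A n)" for n unfolding A'(2) using h by force
  have A'mono: "univ (A' n) \<subseteq> univ (A' (Suc n))" for n
    unfolding A'h by (rule image_mono[OF mono])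
  obtain U' where U': "strong K U' C" "univ U' = (\<Union>n. univ (A' n))"
    using A'(1) A'mono by (rule omega_chain_union)
  have U'h: "univ U' = h ` univ U" unfolding U'(2) U(2) A'h by blast
  have UC: "strong K U C" using U(1) PC by (rule strong_trans)
  have inj: "inj_on h (univ U)"
  proof (rule inj_onI)
    fix x y assume xy: "x \<in> univ U" "y \<in> univ U" "h x = h y"
    then obtain n where n: "{x, y} \<subseteq> univ (A n)" using fin[of "{x, y}"] U(2) by auto
    then have "\<tau> n x = \<tau> n y" using xy(3) h[of x n] h[of y n] by simp
    then show "x = y"
      by (rule inj_onD[OF bij_betw_imp_inj_on[OF Aut_bij[OF \<tau>]]]) (use n AuC[of n] in auto)
  qed
  have iso: "struct_iso (voc K) h U U'"
  proof (rule struct_iso_of_locally_Aut[OF strongD(3)[OF UC] strongD(3)[OF U'(1)]])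
    show "bij_betw h (univ U) (univ U')" unfolding U'h using inj by (rule inj_on_imp_bij_betw)
    fix F assume "finite F" "F \<subseteq> univ U"
    then obtain n where "F \<subseteq> univ (A n)" using fin[of F] unfolding U(2) by blast
    then have "\<forall>x\<in>F. \<tau> n x = h x" using h by auto
    then show "\<exists>\<sigma>\<in>Aut K C {}. \<forall>x\<in>F. \<sigma> x = h x" using \<tau> by blast
  qed
  have Us: "|univ U| <o |univ C|"
    by (rule ordLeq_ordLess_trans[OF card_of_mono1[OF strong_univ[OF U(1)]]])
      (use P in \<open>simp add: small_model_def\<close>)
  have "|univ U'| <o |univ C|"
    unfolding U'h using card_of_image Us by (rule ordLeq_ordLess_trans)
  then obtain \<rho> where \<rho>: "\<rho> \<in> Aut K C {}" "\<forall>x\<in>univ U. \<rho> x = h x"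
    using homogeneity[OF _ _ iso] UC U'(1) Us unfolding small_model_def by blast
  have \<rho>i: "inv_into (univ C) \<rho> \<in> Aut K C {}" using \<rho>(1) by (rule Aut_inv) simp
  show thesis
  proof (rule that)
    show "inv_into (univ C) \<rho> (b 0) \<in> univ C" using \<rho>i b0 by (rule Aut_closed)
    fix n
    \<comment> \<open>On \<open>A n\<close> both \<open>\<tau> n\<close> and \<open>\<rho>\<close>
      agree with \<open>h\<close>, so the composite fixes \<open>A n\<close>. It carries
      \<open>b n\<close> to the witness because \<open>\<tau> n\<close> carries \<open>b n\<close>
      to \<open>b 0\<close>.\<close>
    have "(inv_into (univ C) \<rho> \<circ> \<tau> n) x = x" if x: "x \<in> univ (A n)" for x
    proof -
      have "\<tau> n x = \<rho> x" using h[OF x] \<rho>(2) x U(2) by auto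
      then show ?thesis using Aut_inv_apply(1)[OF \<rho>(1)] x AuC by auto
    qed
    then have "inv_into (univ C) \<rho> \<circ> \<tau> n \<in> Aut K C (univ (A n))"
      using Aut_iso[OF Aut_comp[OF \<rho>i \<tau>]] by (simp add: Aut_def)
    then have "(inv_into (univ C) \<rho> \<circ> \<tau> n) (b n) \<in> gtp1 K C (b n) (univ (A n))"
      by (rule gtp1I)
    then show "inv_into (univ C) \<rho> (b 0) \<in> gtp1 K C (b n) (univ (A n))"
      by (simp add: \<tau>b)
  qed
qed

end

section \<open>Simple independence relations\<close>

text \<open>The lexicographic minimum exists: minimize the first coordinate, then the second. So the
  choice defining the pair yields a genuine local character bound.\<close>

lemma local_character_bound_pair:
  assumes "simple_independence_relation K C ind"
  shows "local_character_bound K C ind (kappa_ind K C ind, ell_ind K C ind)"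
proof -
  let ?L = "local_character_bound K C ind"
  have wo: "Well_order \<kappa> \<and> Well_order \<theta>" if "?L (\<kappa>, \<theta>)" for \<kappa> \<theta>
    using that card_order_on_well_order_on[of _ \<kappa>] card_order_on_well_order_on[of _ \<theta>]
    unfolding local_character_bound_def by simp
  let ?S = "{\<kappa>. \<exists>\<theta>. ?L (\<kappa>, \<theta>)}"
  have "?S \<noteq> {}" using assms unfolding simple_independence_relation_def by simp
  then obtain \<kappa> where \<kappa>: "\<kappa> \<in> ?S" "\<forall>\<kappa>'\<in>?S. \<kappa> \<le>o \<kappa>'"
    using exists_minim_Well_order[of ?S] wo by blast
  \<comment> \<open>\<open>lex_le\<close> compares first coordinates up to \<open>=o\<close>, so the
    second is minimized over all pairs whose first coordinate is isomorphic to
    \<open>\<kappa>\<close>, not only equal to it.\<close>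
  let ?T = "{\<theta>. \<exists>\<kappa>'. \<kappa> =o \<kappa>' \<and> ?L (\<kappa>', \<theta>)}"
  have "\<kappa> =o \<kappa>" using \<kappa>(1) wo ordIso_reflexive by blast
  then have "?T \<noteq> {}" using \<kappa>(1) by blast
  then obtain \<theta> where \<theta>: "\<theta> \<in> ?T" "\<forall>\<theta>'\<in>?T. \<theta> \<le>o \<theta>'"
    using exists_minim_Well_order[of ?T] wo by blast
  then obtain \<kappa>' where \<kappa>': "\<kappa> =o \<kappa>'" "?L (\<kappa>', \<theta>)" by blast
  have "lex_le (\<kappa>', \<theta>) y" if y: "?L y" for y
  proof -
    obtain \<kappa>'' \<theta>'' where y2: "y = (\<kappa>'', \<theta>'')" by (cases y)
    have "\<kappa> \<le>o \<kappa>''" using \<kappa>(2) y unfolding y2 by blast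
    then have le: "\<kappa>' \<le>o \<kappa>''" by (rule ordIso_ordLeq_trans[OF ordIso_symmetric[OF \<kappa>'(1)]])
    show ?thesis
    proof (cases "\<kappa>' =o \<kappa>''")
      case True
      then have "\<kappa> =o \<kappa>''" by (rule ordIso_transitive[OF \<kappa>'(1)])
      then have "\<theta> \<le>o \<theta>''" using \<theta>(2) y unfolding y2 by blast
      with True show ?thesis by (simp add: lex_le_def y2)
    next
      case False
      then show ?thesis using le by (simp add: lex_le_def y2 ordLeq_iff_ordLess_or_ordIso)
    qed
  qed
  then have "\<exists>x. ?L x \<and> (\<forall>y. ?L y \<longrightarrow> lex_le x y)" using \<kappa>'(2) by blast
  then have "?L (local_character_pair K C ind)"
    unfolding local_character_pair_def by (rule someI2_ex) (erule conjunct1)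
  then show ?thesis by (simp add: kappa_ind_def ell_ind_def)
qed

text \<open>Elements are coded as sequences indexed by a fixed one-point well-order.\<close>

definition one_ord :: "'a rel" where
  "one_ord = {(undefined, undefined)}"

definition sng :: "'a \<Rightarrow> 'a \<Rightarrow> 'a" where
  "sng a = (\<lambda>x\<in>{undefined}. a)"

lemma Field_one_ord: "Field one_ord = {undefined}"
  by (auto simp: one_ord_def Field_def)

lemma Well_order_one_ord: "Well_order one_ord"
  unfolding one_ord_def well_order_on_def linear_order_on_def partial_order_on_def
    preorder_on_def refl_on_def trans_def antisym_def total_on_def
  by (auto simp: Field_def)

lemma sng_inject: "sng a = sng b \<longleftrightarrow> a = b"
  by (auto simp: sng_def fun_eq_iff)

lemma sng_image: "sng a ` Field one_ord = {a}"
  by (auto simp: sng_def Field_one_ord)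

lemma sng_seqs: "a \<in> univ C \<Longrightarrow> sng a \<in> seqs C one_ord"
  by (auto simp: sng_def seqs_def Field_one_ord)

lemma seqs_one_ordE:
  assumes "b \<in> seqs C one_ord"
  obtains a where "a \<in> univ C" and "b = sng a"
proof
  show "b undefined \<in> univ C" using assms by (auto simp: seqs_def Field_one_ord)
  show "b = sng (b undefined)"
    using assms by (auto simp: seqs_def Field_one_ord sng_def PiE_def extensional_def fun_eq_iff)
qed

lemma extends_one_ordE:
  assumes "extends K C one_ord q B p A"
  obtains c where "c \<in> univ C" and "q = gtp K C one_ord (sng c) B" and "p = gtp K C one_ord (sng c) A"
proof -
  obtain b where b: "b \<in> seqs C one_ord" "q = gtp K C one_ord b B" "p = gtp K C one_ord b A"
    using assms unfolding extends_def by (elim conjE bexE)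
  from b(1) obtain c where "c \<in> univ C" "b = sng c" by (rule seqs_one_ordE)
  with b(2,3) show thesis by (intro that) simp_all
qed

lemma nonforking_one_ordE:
  assumes "nonforking K C ind one_ord p B M"
  obtains c where "c \<in> univ C" and "p = gtp K C one_ord (sng c) B" and "ind {c} M B"
proof -
  obtain b where b: "b \<in> seqs C one_ord" "p = gtp K C one_ord b B" "ind (b ` Field one_ord) M B"
    using assms unfolding nonforking_def by (elim conjE bexE)
  from b(1) obtain c where "c \<in> univ C" "b = sng c" by (rule seqs_one_ordE)
  with b(2,3) show thesis by (intro that) (simp_all add: sng_image)
qed

lemma gtp_sng: "gtp K C one_ord (sng a) A = sng ` gtp1 K C a A"
proof -
  have "compose (Field one_ord) \<sigma> (sng a) = sng (\<sigma> a)" for \<sigma> :: "'a \<Rightarrow> 'a"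
    by (auto simp: compose_def sng_def Field_one_ord fun_eq_iff)
  then show ?thesis unfolding gtp_def gtp1_def by auto
qed

lemma gtp_sng_inject:
  "gtp K C one_ord (sng a) A = gtp K C one_ord (sng b) A \<longleftrightarrow> gtp1 K C a A = gtp1 K C b A"
  unfolding gtp_sng by (rule inj_image_eq_iff) (simp add: inj_def sng_inject)

section \<open>Rules for independence of sets\<close>

locale simple_class = monster_class K C
  for K :: "('a, 'f, 'r) aclass" and C :: "('a, 'f, 'r) struct" +
  fixes ind :: "('a, 'f, 'r) indep"
  assumes simple: "simple_independence_relation K C ind"
begin

abbreviation "\<kappa> \<equiv> kappa_ind K C ind"
abbreviation "\<theta> \<equiv> ell_ind K C ind"

lemma kappa_Cinfinite: "Cinfinite \<kappa>" and kappa_less: "\<kappa> <o |univ C|"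
  using local_character_bound_pair[OF simple] unfolding local_character_bound_def by simp_all

lemma local_character:
  "\<forall>\<alpha> M. \<forall>p\<in>gS K C \<alpha> (univ M). small_ordinal C \<alpha> \<and> small_model K C M \<longrightarrow>
     (\<exists>M0. strong K M0 M \<and> |univ M0| \<le>o \<kappa> +c cpow_less |Field \<alpha>| \<theta> \<and>
       nonforking K C ind \<alpha> p (univ M) M0)"
  using local_character_bound_pair[OF simple] unfolding local_character_bound_def by simp

lemma independence: "independence_relation K C ind"
  and symmetric: "symmetric_ind K C ind"
  and type_amalg: "type_amalgamation K C ind"
  using simple unfolding simple_independence_relation_def by simp_all

lemma infinite_C: "infinite (univ C)"
proof -
  have "cinfinite |univ C|"
    using ordLess_imp_ordLeq[OF kappa_less] kappa_Cinfinite cinfinite_mono by blast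
  then show ?thesis by (simp add: cinfinite_def Field_card_of)
qed

lemma singleton_less_C:
  fixes x :: 'a
  shows "|{x}| <o |univ C|"
  by (rule finite_ordLess_infinite)
    (simp_all add: card_of_well_order_on Field_card_of infinite_C)

lemma small_ordinal_one_ord: "small_ordinal C one_ord"
  unfolding small_ordinal_def Field_one_ord using Well_order_one_ord singleton_less_C
  by (simp add: Field_one_ord)

lemma small_set_singleton: "a \<in> univ C \<Longrightarrow> small_set C {a}"
  unfolding small_set_def using singleton_less_C by simp

lemma small_set_model: "small_model K C M \<Longrightarrow> small_set C (univ M)"
  unfolding small_set_def small_model_def using strong_univ by blast

lemma small_model_strong:
  assumes "strong K N M" and "small_model K C M"
  shows "small_model K C N"
proof -
  have M: "strong K M C" "|univ M| <o |univ C|" using assms(2) by (auto simp: small_model_def)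
  show ?thesis unfolding small_model_def
    using strong_trans[OF assms(1) M(1)]
      ordLeq_ordLess_trans[OF card_of_mono1[OF strong_univ[OF assms(1)]] M(2)] ..
qed

lemma small_set_subset:
  assumes "A \<subseteq> B" and "small_set C B"
  shows "small_set C A"
proof -
  have B: "B \<subseteq> univ C" "|B| <o |univ C|" using assms(2) by (auto simp: small_set_def)
  show ?thesis unfolding small_set_def
    using subset_trans[OF assms(1) B(1)] ordLeq_ordLess_trans[OF card_of_mono1[OF assms(1)] B(2)] ..
qed

text \<open>An automorphism fixing \<open>B\<close> pointwise maps \<open>B\<close> and
  \<open>M\<close> to themselves, so invariance moves only the left-hand side.\<close>

lemma ind_invariant:
  assumes "\<sigma> \<in> Aut K C B" and "univ M \<subseteq> B" and "small_set C A" and "small_set C B"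
    and "small_model K C M" and "ind A M B"
  shows "ind (\<sigma> ` A) M B"
proof -
  have "M \<in> models K" using assms(5) strongD(1)[of M C] by (simp add: small_model_def)
  then have "struct_iso (voc K) \<sigma> M M"
    using Aut_fixes[OF assms(1)] assms(2) by (intro struct_iso_id model_is_struct) auto
  moreover have "\<sigma> \<in> Aut K C {}" using assms(1) by (rule Aut_antimono) simp
  moreover have "\<forall>\<sigma>\<in>Aut K C {}. \<forall>A M B M'. small_set C A \<and> small_set C B \<and>
        small_model K C M \<and> small_model K C M' \<and> struct_iso (voc K) \<sigma> M M' \<longrightarrow>
        (ind A M B \<longleftrightarrow> ind (\<sigma> ` A) M' (\<sigma> ` B))"
    using independence unfolding independence_relation_def by (elim conjE)
  moreover have "\<sigma> ` B = B" using Aut_fixes[OF assms(1)] by (auto simp: image_iff)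
  ultimately show ?thesis using assms(3-6) by metis
qed

lemma ind_mono:
  assumes "ind A M B" and "A' \<subseteq> A" and "B' \<subseteq> B"
    and "small_set C A" and "small_set C B" and "small_model K C M"
  shows "ind A' M B'"
proof -
  have "\<forall>A M B A' B'. small_set C A \<and> small_set C B \<and> small_model K C M \<and>
        ind A M B \<and> A' \<subseteq> A \<and> B' \<subseteq> B \<longrightarrow> ind A' M B'"
    using independence unfolding independence_relation_def by (elim conjE)
  then show ?thesis using assms by blast
qed

lemma ind_normal:
  assumes "ind A M B" and "small_set C A" and "small_set C B" and "small_model K C M"
  shows "ind (A \<union> univ M) M (B \<union> univ M)"
proof -
  have "\<forall>A M B. small_set C A \<and> small_set C B \<and> small_model K C M \<longrightarrow>
        (ind A M B \<longleftrightarrow> ind (A \<union> univ M) M (B \<union> univ M))"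
    using independence unfolding independence_relation_def by (elim conjE)
  then show ?thesis using assms by blast
qed

lemma ind_base_mono:
  assumes "ind A M B" and "strong K M N" and "univ N \<subseteq> B"
    and "small_set C A" and "small_set C B" and "small_model K C N"
  shows "ind A N B"
proof -
  have "\<forall>A M B N. small_set C A \<and> small_set C B \<and> small_model K C M \<and> small_model K C N \<and>
        ind A M B \<and> strong K M N \<and> univ N \<subseteq> B \<longrightarrow> ind A N B"
    using independence unfolding independence_relation_def by (elim conjE)
  then show ?thesis using assms small_model_strong[OF assms(2,6)] by blast
qed

lemma ind_trans:
  assumes "ind A M (univ N)" and "ind A N B" and "strong K M N"
    and "small_set C A" and "small_set C B" and "small_model K C N"
  shows "ind A M B"
proof -
  have "\<forall>A M N B. small_set C A \<and> small_set C B \<and> small_model K C M \<and> small_model K C N \<and>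
        strong K M N \<and> ind A M (univ N) \<and> ind A N B \<longrightarrow> ind A M B"
    using independence unfolding independence_relation_def by (elim conjE)
  then show ?thesis using assms small_model_strong[OF assms(3,6)] by blast
qed

lemma ind_sym:
  assumes "ind A M B" and "small_set C A" and "small_set C B" and "small_model K C M"
  shows "ind B M A"
  using symmetric assms unfolding symmetric_ind_def by blast

section \<open>Nonforking types and their realizations\<close>

text \<open>\<open>nonforking\<close> provides just one independent realization. Any other is its
  image under an automorphism fixing \<open>B\<close>, so invariance transfers the
  independence.\<close>

lemma nonforking_gtpD:
  assumes nf: "nonforking K C ind \<alpha> (gtp K C \<alpha> b B) B M" and \<alpha>: "small_ordinal C \<alpha>"
    and b: "b \<in> seqs C \<alpha>" and MB: "univ M \<subseteq> B" and B: "small_set C B" and M: "small_model K C M"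
  shows "ind (b ` Field \<alpha>) M B"
proof -
  obtain b' where b': "b' \<in> seqs C \<alpha>" "gtp K C \<alpha> b B = gtp K C \<alpha> b' B" "ind (b' ` Field \<alpha>) M B"
    using nf unfolding nonforking_def by blast
  have "compose (Field \<alpha>) id b = b"
    using b by (auto simp: seqs_def compose_def PiE_def extensional_def fun_eq_iff)
  then have "b \<in> gtp K C \<alpha> b B" unfolding gtp_def using Aut_id by force
  then have "b \<in> gtp K C \<alpha> b' B" by (simp only: b'(2))
  then obtain \<sigma> where \<sigma>: "\<sigma> \<in> Aut K C B" "b = compose (Field \<alpha>) \<sigma> b'"
    unfolding gtp_def by (elim CollectE exE conjE)
  have "|b' ` Field \<alpha>| <o |univ C|"
    by (rule ordLeq_ordLess_trans[OF card_of_image]) (use \<alpha> in \<open>simp add: small_ordinal_def\<close>)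
  moreover have "b' ` Field \<alpha> \<subseteq> univ C" using b'(1) by (auto simp: seqs_def)
  ultimately have "small_set C (b' ` Field \<alpha>)" by (simp add: small_set_def)
  from ind_invariant[OF \<sigma>(1) MB this B M b'(3)] have "ind (\<sigma> ` b' ` Field \<alpha>) M B" .
  moreover have "\<sigma> ` b' ` Field \<alpha> = b ` Field \<alpha>"
    unfolding \<sigma>(2) compose_def by (simp add: image_image)
  ultimately show ?thesis by simp
qed

lemma nonforking_sng:
  assumes "ind {a} M B" and "a \<in> univ C"
  shows "nonforking K C ind one_ord (gtp K C one_ord (sng a) B) B M"
  unfolding nonforking_def using assms sng_seqs[OF assms(2)] sng_image by metis

lemma nonforking_existence:
  assumes a: "a \<in> univ C" and MN: "strong K M N" and N: "small_model K C N"
  obtains b where "b \<in> gtp1 K C a (univ M)" and "ind {b} M (univ N)"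
proof -
  let ?tp = "\<lambda>a A. gtp K C one_ord (sng a) A"
  have M: "small_model K C M" using MN N by (rule small_model_strong)
  have "\<forall>\<alpha> M N. \<forall>p\<in>gS K C \<alpha> (univ M). small_ordinal C \<alpha> \<and> small_model K C M \<and>
        small_model K C N \<and> strong K M N \<longrightarrow>
        (\<exists>q\<in>gS K C \<alpha> (univ N). extends K C \<alpha> q (univ N) p (univ M) \<and>
           nonforking K C ind \<alpha> q (univ N) M)"
    using independence unfolding independence_relation_def by (elim conjE)
  moreover have "?tp a (univ M) \<in> gS K C one_ord (univ M)"
    using sng_seqs[OF a] unfolding gS_def by blast
  ultimately obtain q where q: "extends K C one_ord q (univ N) (?tp a (univ M)) (univ M)"
      "nonforking K C ind one_ord q (univ N) M"
    using small_ordinal_one_ord M N MN by meson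
  obtain c where c: "c \<in> univ C" "q = ?tp c (univ N)" "?tp a (univ M) = ?tp c (univ M)"
    using q(1) by (rule extends_one_ordE)
  obtain b where b: "b \<in> univ C" "q = ?tp b (univ N)" "ind {b} M (univ N)"
    using q(2) by (rule nonforking_one_ordE)
  have "gtp1 K C b (univ N) = gtp1 K C c (univ N)" "gtp1 K C a (univ M) = gtp1 K C c (univ M)"
    using b(2) c(2,3) gtp_sng_inject by metis+
  then have "b \<in> gtp1 K C a (univ M)"
    using gtp1_antimono[OF _ strong_univ[OF MN]] gtp1_self by metis
  then show thesis using b(3) by (rule that)
qed

lemma local_character_element:
  assumes a: "a \<in> univ C" and N: "small_model K C N"
  obtains M0 where "strong K M0 N" and "|univ M0| \<le>o \<kappa>" and "ind {a} M0 (univ N)"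
proof -
  have "gtp K C one_ord (sng a) (univ N) \<in> gS K C one_ord (univ N)"
    using sng_seqs[OF a] unfolding gS_def by blast
  then obtain M0 where M0: "strong K M0 N" "|univ M0| \<le>o \<kappa> +c cpow_less |Field one_ord| \<theta>"
      "nonforking K C ind one_ord (gtp K C one_ord (sng a) (univ N)) (univ N) M0"
    using local_character small_ordinal_one_ord N by meson
  have "cpow_less |Field one_ord| \<theta> \<le>o cone" unfolding Field_one_ord by (rule cpow_less_singleton)
  also have "cone \<le>o \<kappa>" using cone_ordLeq_Cnotzero Cinfinite_Cnotzero[OF kappa_Cinfinite] by blast
  finally have "\<kappa> +c cpow_less |Field one_ord| \<theta> =o \<kappa>"
    by (rule csum_absorb1[OF kappa_Cinfinite])
  with M0(2) have le: "|univ M0| \<le>o \<kappa>" by (rule ordLeq_ordIso_trans)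
  have "ind (sng a ` Field one_ord) M0 (univ N)"
    using M0(3) small_ordinal_one_ord sng_seqs[OF a] strong_univ[OF M0(1)] small_set_model[OF N]
      small_model_strong[OF M0(1) N] by (rule nonforking_gtpD)
  then have "ind {a} M0 (univ N)" unfolding sng_image .
  with M0(1) le show thesis by (rule that)
qed

text \<open>The set is enumerated, possibly with repetitions, in length \<mu>. The assumption on
  \<open>cpow_less\<close> then keeps the local character bound at \<mu>.\<close>

lemma local_character_set:
  assumes X: "X \<subseteq> univ C" "X \<noteq> {}" "|X| \<le>o \<mu>" and \<mu>: "Cinfinite \<mu>" "\<mu> <o |univ C|"
    and \<kappa>: "\<kappa> \<le>o \<mu>" and pow: "cpow_less \<mu> \<theta> =o \<mu>" and D: "small_model K C D"
  obtains M0 where "strong K M0 D" and "|univ M0| \<le>o \<mu>" and "ind X M0 (univ D)"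
proof -
  have F: "|Field \<mu>| =o \<mu>" using \<mu>(1) card_of_Field_ordIso by blast
  have "|X| \<le>o |Field \<mu>|" using X(3) ordIso_symmetric[OF F] by (rule ordLeq_ordIso_trans)
  then obtain e where e: "e ` Field \<mu> = X" using X(2) by (rule card_of_le_imp_surj)
  let ?b = "restrict e (Field \<mu>)"
  have b: "?b \<in> seqs C \<mu>" using e X(1) by (auto simp: seqs_def)
  have im: "?b ` Field \<mu> = X" using e by simp
  have sm: "small_ordinal C \<mu>"
    unfolding small_ordinal_def
    using \<mu> card_order_on_well_order_on ordIso_ordLess_trans[OF F \<mu>(2)] by blast
  have "gtp K C \<mu> ?b (univ D) \<in> gS K C \<mu> (univ D)" using b unfolding gS_def by blast
  then obtain M0 where M0: "strong K M0 D" "|univ M0| \<le>o \<kappa> +c cpow_less |Field \<mu>| \<theta>"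
      "nonforking K C ind \<mu> (gtp K C \<mu> ?b (univ D)) (univ D) M0"
    using local_character sm D by meson
  have "cpow_less |Field \<mu>| \<theta> \<le>o cpow_less \<mu> \<theta>"
    using ordIso_imp_ordLeq[OF F] by (rule cpow_less_mono1)
  then have "cpow_less |Field \<mu>| \<theta> \<le>o \<mu>" using pow by (rule ordLeq_ordIso_trans)
  then have "\<kappa> +c cpow_less |Field \<mu>| \<theta> \<le>o \<mu> +c \<mu>" by (rule csum_mono[OF \<kappa>])
  also have "\<mu> +c \<mu> =o \<mu>" using \<mu>(1) ordLeq_refl by (intro csum_absorb1) blast+
  finally have le: "|univ M0| \<le>o \<mu>" by (rule ordLeq_transitive[OF M0(2)])
  have "ind (?b ` Field \<mu>) M0 (univ D)"
    using M0(3) sm b strong_univ[OF M0(1)] small_set_model[OF D] small_model_strong[OF M0(1) D]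
    by (rule nonforking_gtpD)
  then have "ind X M0 (univ D)" unfolding im .
  with M0(1) le show thesis by (rule that)
qed

lemma amalgamate_elements:
  assumes M: "small_model K C M" and N: "small_model K C N"
    and A: "univ M \<subseteq> A" "A \<subseteq> univ N" and B: "univ M \<subseteq> B" "B \<subseteq> univ N" and AB: "ind A M B"
    and a: "a \<in> univ C" "ind {a} M A" and b: "b \<in> univ C" "ind {b} M B"
    and ab: "gtp1 K C a (univ M) = gtp1 K C b (univ M)"
  obtains c where "c \<in> gtp1 K C a A" and "c \<in> gtp1 K C b B" and "ind {c} M (univ N)"
proof -
  let ?tp = "\<lambda>a A. gtp K C one_ord (sng a) A"
  have sA: "small_set C A" "small_set C B"
    using small_set_subset[OF A(2)] small_set_subset[OF B(2)] small_set_model[OF N] by simp_all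
  have gS: "?tp x X \<in> gS K C one_ord X" if "x \<in> univ C" for x X
    using sng_seqs[OF that] unfolding gS_def by blast
  have "extends K C one_ord (?tp a A) A (?tp a (univ M)) (univ M)"
    using A(1) sng_seqs[OF a(1)] unfolding extends_def by blast
  moreover have "extends K C one_ord (?tp b B) B (?tp a (univ M)) (univ M)"
    using B(1) sng_seqs[OF b(1)] ab gtp_sng_inject[of K C a "univ M" b] unfolding extends_def by blast
  moreover have "A \<union> B \<subseteq> univ N" using A(2) B(2) by blast
  ultimately obtain q where q: "extends K C one_ord q (univ N) (?tp a A) A"
      "extends K C one_ord q (univ N) (?tp b B) B" "nonforking K C ind one_ord q (univ N) M"
    using type_amalg[unfolded type_amalgamation_def, rule_format,
        of one_ord M A B N "?tp a (univ M)" "?tp a A" "?tp b B"]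
      small_ordinal_one_ord M N sA A(1) B(1) AB gS[OF a(1)] gS[OF b(1)]
      nonforking_sng[OF a(2,1)] nonforking_sng[OF b(2,1)]
    by meson
  \<comment> \<open>Each of the three properties of \<open>q\<close> comes with its own realization.
    The independent one, \<open>c\<close>, is kept; it has the same type over \<open>N\<close> as
    the others, hence the required types over \<open>A\<close> and \<open>B\<close>.\<close>
  obtain c1 where c1: "q = ?tp c1 (univ N)" "?tp a A = ?tp c1 A"
    using q(1) by (rule extends_one_ordE)
  obtain c2 where c2: "q = ?tp c2 (univ N)" "?tp b B = ?tp c2 B"
    using q(2) by (rule extends_one_ordE)
  obtain c where c: "q = ?tp c (univ N)" "ind {c} M (univ N)"
    using q(3) by (rule nonforking_one_ordE)
  have eqs: "gtp1 K C c (univ N) = gtp1 K C c1 (univ N)" "gtp1 K C c (univ N) = gtp1 K C c2 (univ N)"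
      "gtp1 K C a A = gtp1 K C c1 A" "gtp1 K C b B = gtp1 K C c2 B"
    using c(1) c1 c2 gtp_sng_inject by metis+
  have "c \<in> gtp1 K C c1 (univ N)" "c \<in> gtp1 K C c2 (univ N)"
    using gtp1_self eqs(1,2) by metis+
  then have "c \<in> gtp1 K C a A" "c \<in> gtp1 K C b B"
    unfolding eqs(3,4) using A(2) B(2) by (auto elim: gtp1_antimono)
  then show thesis using c(2) by (rule that)
qed

end

section \<open>Independent sequences\<close>

text \<open>An increasing chain of length \<open>cardSuc \<mu>\<close> is built in which each member
  absorbs \<open>G\<close> on the small subsets of what came before. This length is regular, so a
  small subset of the union already lies in one member.\<close>

lemma (in monster_class) closed_submodel:
  assumes M: "M \<in> models K" and \<mu>: "Card_order \<mu>" "LS K \<le>o \<mu>" "\<mu> <o |univ C|"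
    and G: "\<And>U. U \<subseteq> univ M \<Longrightarrow> U \<noteq> {} \<Longrightarrow> |U| \<le>o \<mu> \<Longrightarrow> G U \<subseteq> univ M \<and> |G U| \<le>o ctwo ^c \<mu>"
  obtains D where "strong K D M" and "|univ D| \<le>o ctwo ^c \<mu>"
    and "\<And>U. U \<subseteq> univ D \<Longrightarrow> U \<noteq> {} \<Longrightarrow> |U| \<le>o \<mu> \<Longrightarrow> G U \<subseteq> univ D"
proof -
  have inf: "Cinfinite \<mu>" using \<mu>(2,1) by (rule Cinfinite_if_LS_le)
  have inf2: "Cinfinite (ctwo ^c \<mu>)" using inf by (rule Cinfinite_ctwo_cexp)
  have LS2: "LS K \<le>o ctwo ^c \<mu>" using \<mu>(2) ordLeq_ctwo_cexp[OF \<mu>(1)] by (rule ordLeq_transitive)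
  let ?sub = "\<lambda>X. {U. U \<subseteq> X \<and> U \<noteq> {} \<and> |U| \<le>o \<mu>}"
  define step where "step X E \<longleftrightarrow> strong K E M \<and> |univ E| \<le>o ctwo ^c \<mu> \<and>
      X \<union> (\<Union>U\<in>?sub X. G U) \<subseteq> univ E" for X and E :: "('a, 'f, 'r) struct"
  define E where "E X = (SOME E. step X E)" for X
  have E: "step X (E X)" if X: "X \<subseteq> univ M" "|X| \<le>o ctwo ^c \<mu>" for X
  proof -
    have "|\<Union>U\<in>?sub X. G U| \<le>o ctwo ^c \<mu>"
    proof (rule UNION_Cinfinite_bound)
      show "|?sub X| \<le>o ctwo ^c \<mu>" using X(2) inf by (rule small_subsets_ctwo_cexp)
      show "\<forall>U\<in>?sub X. |G U| \<le>o ctwo ^c \<mu>" using G X(1) by blast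
    qed (rule inf2)
    with X(2) have le: "|X \<union> (\<Union>U\<in>?sub X. G U)| \<le>o ctwo ^c \<mu>" using inf2 by (rule Un_Cinfinite_bound)
    have "X \<union> (\<Union>U\<in>?sub X. G U) \<subseteq> univ M" using G X(1) by blast
    then obtain E where "strong K E M" "X \<union> (\<Union>U\<in>?sub X. G U) \<subseteq> univ E" "|univ E| \<le>o ctwo ^c \<mu>"
      using le Card_order_cexp LS2 by (rule obtain_submodel[OF M])
    then have "step X E" unfolding step_def by blast
    then show ?thesis unfolding E_def by (rule someI)
  qed
  let ?s = "cardSuc \<mu>"
  have s: "Card_order ?s" using \<mu>(1) by (rule cardSuc_Card_order)
  have wo: "Well_order ?s" using s by (rule card_order_on_well_order_on)
  interpret wo_rel ?s using wo by (simp add: wo_rel_def)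
  \<comment> \<open>\<open>H\<close> looks only at values below \<open>i\<close>, so recursion along
    \<open>cardSuc \<mu>\<close> applies. Each stage extends the union of all earlier ones.\<close>
  define H where "H D i = E (\<Union>j\<in>underS i. univ (D j))"
    for D :: "_ \<Rightarrow> ('a, 'f, 'r) struct" and i
  define D where "D = worec H"
  define X where "X i = (\<Union>j\<in>underS i. univ (D j))" for i
  have "adm_wo H" unfolding adm_wo_def H_def by simp
  then have D_eq: "D i = E (X i)" for i
    using worec_fixpoint[of H] unfolding D_def X_def H_def by metis
  have D: "i \<in> Field ?s \<longrightarrow> strong K (D i) M \<and> |univ (D i)| \<le>o ctwo ^c \<mu> \<and>
      X i \<union> (\<Union>U\<in>?sub (X i). G U) \<subseteq> univ (D i)" for i
  proof (induction i rule: well_order_induct)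
    case (1 i)
    show ?case
    proof
      assume i: "i \<in> Field ?s"
      have IH: "strong K (D j) M" "|univ (D j)| \<le>o ctwo ^c \<mu>" if "j \<in> underS i" for j
      proof -
        have "j \<noteq> i" "(j, i) \<in> ?s" "j \<in> Field ?s"
          using that by (auto simp: Order_Relation.underS_def Field_def)
        then show "strong K (D j) M" "|univ (D j)| \<le>o ctwo ^c \<mu>" using 1 by simp_all
      qed
      \<comment> \<open>Fewer than \<open>cardSuc \<mu>\<close> predecessors means at most \<mu>, so
        the union of the earlier stages keeps size at most \<open>ctwo ^c \<mu>\<close>.\<close>
      have "|underS i| <o ?s" using s i by (rule card_of_underS)
      then have "|underS i| \<le>o \<mu>"
        unfolding cardSuc_ordLeq_ordLess[OF \<mu>(1) card_of_Card_order] .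
      then have "|underS i| \<le>o ctwo ^c \<mu>"
        using ordLeq_ctwo_cexp[OF \<mu>(1)] by (rule ordLeq_transitive)
      then have "|X i| \<le>o ctwo ^c \<mu>"
        unfolding X_def by (rule UNION_Cinfinite_bound) (use IH(2) inf2 in auto)
      moreover have "X i \<subseteq> univ M" unfolding X_def using IH(1) strong_univ by blast
      ultimately show "strong K (D i) M \<and> |univ (D i)| \<le>o ctwo ^c \<mu> \<and>
          X i \<union> (\<Union>U\<in>?sub (X i). G U) \<subseteq> univ (D i)"
        using E[of "X i"] unfolding D_eq step_def by blast
    qed
  qed
  have mono: "univ (D i) \<subseteq> univ (D j)" if "(i, j) \<in> ?s" for i j
  proof (cases "i = j")
    case False
    then have "i \<in> underS j" using that by (simp add: Order_Relation.underS_def)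
    then have "univ (D i) \<subseteq> X j" unfolding X_def by blast
    moreover have "j \<in> Field ?s" using that by (auto simp: Field_def)
    ultimately show ?thesis using D[of j] by blast
  qed simp
  have infs: "infinite (Field ?s)" using Cinfinite_cardSuc[OF inf] by (simp add: cinfinite_def)
  have lim: "\<exists>j\<in>Field ?s. i \<noteq> j \<and> (i, j) \<in> ?s" if "i \<in> Field ?s" for i
    using s infs that by (rule infinite_Card_order_limit)
  have sF: "|Field ?s| =o ?s" using s by (rule card_of_Field_ordIso)
  \<comment> \<open>This bound supplies the injection of the index set into the type of the elements
    that \<open>chain_union\<close> requires.\<close>
  have "?s \<le>o |univ C|" using \<mu>(1) card_of_Card_order \<mu>(3) by (rule cardSuc_least)
  with sF have "|Field ?s| \<le>o |univ C|" by (rule ordIso_ordLeq_trans)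
  then obtain f :: "_ \<Rightarrow> 'a" where f: "inj_on f (Field ?s)"
    unfolding card_of_ordLeq[symmetric] by (elim exE conjE)
  obtain D' where D': "strong K D' M" "univ D' = (\<Union>i\<in>Field ?s. univ (D i))"
  proof (rule chain_union[OF wo f])
    show "Field ?s \<noteq> {}" using infs by auto
    show "\<forall>i\<in>Field ?s. \<exists>j. (i, j) \<in> ?s \<and> j \<noteq> i" using lim by blast
    show "\<forall>i\<in>Field ?s. strong K (D i) M" using D by blast
  qed (use mono in blast)+
  show thesis
  proof (rule that)
    show "strong K D' M" by (rule D'(1))
    have "?s \<le>o ctwo ^c \<mu>"
      using \<mu>(1) Card_order_cexp ordLess_ctwo_cexp[OF \<mu>(1)] by (rule cardSuc_least)
    with sF have "|Field ?s| \<le>o ctwo ^c \<mu>" by (rule ordIso_ordLeq_trans)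
    then show "|univ D'| \<le>o ctwo ^c \<mu>"
      unfolding D'(2) using D inf2 by (intro UNION_Cinfinite_bound) blast+
    fix U assume U: "U \<subseteq> univ D'" "U \<noteq> {}" "|U| \<le>o \<mu>"
    have "relChain ?s (\<lambda>i. univ (D i))" unfolding relChain_def using mono by blast
    then obtain i where i: "i \<in> Field ?s" "U \<subseteq> univ (D i)"
      using cardSuc_UNION_Cinfinite[OF inf _ U(1)[unfolded D'(2)] U(3)] by blast
    \<comment> \<open>Stage \<open>i\<close> closes only over earlier stages, so a strictly later
      stage \<open>j\<close> is taken to absorb \<open>G U\<close>.\<close>
    then obtain j where j: "j \<in> Field ?s" "i \<noteq> j" "(i, j) \<in> ?s" using lim by blast
    then have "i \<in> underS j" by (simp add: Order_Relation.underS_def)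
    then have "U \<subseteq> X j" using i(2) unfolding X_def by blast
    then have "G U \<subseteq> univ (D j)" using D[of j] j(1) U(2,3) by blast
    then show "G U \<subseteq> univ D'" unfolding D'(2) using j(1) by blast
  qed
qed

section \<open>A base over which infinitely many types are independent\<close>

context simple_class
begin

text \<open>The conclusion holds for every small \<open>A\<close> above \<open>B\<close>. A
  construction that enlarges \<open>A\<close> step by step therefore always finds a new index whose
  model is independent from what has been built.\<close>

lemma independent_base:
  assumes M: "small_model K C M"
    and \<mu>: "Card_order \<mu>" "LS K \<le>o \<mu>" "\<mu> <o |univ C|" "\<kappa> \<le>o \<mu>" "cpow_less \<mu> \<theta> =o \<mu>"
    and I: "\<And>p. p \<in> I \<Longrightarrow> a p \<in> univ C \<and> strong K (N p) M \<and> |univ (N p)| \<le>o \<mu>"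
    and M0: "strong K M0 M" "|univ M0| \<le>o \<mu>"
    and large: "\<not> |I| \<le>o ctwo ^c \<mu>"
  obtains B c where "strong K B M" and "|univ B| \<le>o \<mu>" and "univ M0 \<subseteq> univ B"
    and "\<And>A. strong K A M \<Longrightarrow> univ B \<subseteq> univ A \<Longrightarrow> |univ A| \<le>o \<mu> \<Longrightarrow>
      infinite {p\<in>I. gtp1 K C (a p) (univ B) = c \<and> ind (univ (N p)) B (univ A)}"
proof (rule ccontr)
  note result = that
  assume no: "\<not> thesis"
  have inf: "Cinfinite \<mu>" using \<mu>(2,1) by (rule Cinfinite_if_LS_le)
  have inf2: "Cinfinite (ctwo ^c \<mu>)" using inf by (rule Cinfinite_ctwo_cexp)
  have MK: "M \<in> models K" and MC: "strong K M C"
    using M strongD(1)[of M C] by (auto simp: small_model_def)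
  define ok where "ok B \<longleftrightarrow> strong K B M \<and> |univ B| \<le>o \<mu> \<and> univ M0 \<subseteq> univ B" for B
  define S where "S B c A = {p\<in>I. gtp1 K C (a p) (univ B) = c \<and> ind (univ (N p)) B (univ A)}"
    for B A :: "('a, 'f, 'r) struct" and c
  define A where "A B c = (SOME A. strong K A M \<and> univ B \<subseteq> univ A \<and> |univ A| \<le>o \<mu> \<and> finite (S B c A))"
    for B c
  have ex_A: "\<exists>A. strong K A M \<and> univ B \<subseteq> univ A \<and> |univ A| \<le>o \<mu> \<and> finite (S B c A)"
    if B: "ok B" for B c
  proof (rule ccontr)
    assume neg: "\<not> ?thesis"
    have thesis
    proof (rule result[of B c])
      show "strong K B M" "|univ B| \<le>o \<mu>" "univ M0 \<subseteq> univ B" using B by (auto simp: ok_def)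
      show "infinite {p\<in>I. gtp1 K C (a p) (univ B) = c \<and> ind (univ (N p)) B (univ A)}"
        if "strong K A M" "univ B \<subseteq> univ A" "|univ A| \<le>o \<mu>" for A
        using neg that unfolding S_def by blast
    qed
    with no show False ..
  qed
  have A: "strong K (A B c) M \<and> univ B \<subseteq> univ (A B c) \<and>
      |univ (A B c)| \<le>o \<mu> \<and> finite (S B c (A B c))" if "ok B" for B c
    unfolding A_def by (rule someI_ex[OF ex_A[OF that]])
  define types where "types U = (\<lambda>x. gtp1 K C x U) ` univ C" for U
  have types: "|types (univ B)| \<le>o ctwo ^c \<mu>" if "ok B" for B
    unfolding types_def using \<mu>(1-3)
  proof (rule card_of_gtp1)
    show "univ B \<subseteq> univ C" using that strong_univ[OF strong_trans[OF _ MC], of B] by (simp add: ok_def)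
    show "|univ B| \<le>o \<mu>" using that by (simp add: ok_def)
  qed
  have ok_inj: "B = B'" if "ok B" "ok B'" "univ B = univ B'" for B B'
    using that strong_univ_inject[of B M B'] unfolding ok_def by blast
  \<comment> \<open>At most one admissible model has universe \<open>U\<close>; for it,
    \<open>G U\<close> collects the counterexamples for all types. Adding \<open>M0\<close> forces
    it into \<open>D\<close>, so that bases containing it can be found there.\<close>
  define G where "G U = univ M0 \<union> (\<Union>B\<in>{B. ok B \<and> univ B = U}. \<Union>c\<in>types U. univ (A B c))" for U
  have G: "G U \<subseteq> univ M \<and> |G U| \<le>o ctwo ^c \<mu>" for U
  proof
    have "univ (A B c) \<subseteq> univ M" if "ok B" for B c using A[OF that] strong_univ by blast
    then show "G U \<subseteq> univ M" unfolding G_def using strong_univ[OF M0(1)] by blast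
    have le: "x \<le>o ctwo ^c \<mu>" if "x \<le>o \<mu>" for x :: "'a rel"
      using that ordLeq_ctwo_cexp[OF \<mu>(1)] by (rule ordLeq_transitive)
    have "|{B. ok B \<and> univ B = U}| \<le>o |{U}|"
      by (rule card_of_ordLeqI[where f = univ]) (use ok_inj in \<open>auto simp: inj_on_def\<close>)
    moreover have "|{U}| \<le>o ctwo ^c \<mu>" using inf2 by (intro finite_ordLeq_Cinfinite) auto
    ultimately have 1: "|{B. ok B \<and> univ B = U}| \<le>o ctwo ^c \<mu>" by (rule ordLeq_transitive)
    have "|\<Union>c\<in>types (univ B). univ (A B c)| \<le>o ctwo ^c \<mu>" if "ok B" for B
      using types[OF that] A[OF that] le inf2 by (intro UNION_Cinfinite_bound) auto
    then have "\<forall>B\<in>{B. ok B \<and> univ B = U}. |\<Union>c\<in>types U. univ (A B c)| \<le>o ctwo ^c \<mu>" by blast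
    from UNION_Cinfinite_bound[OF 1 this inf2] show "|G U| \<le>o ctwo ^c \<mu>"
      unfolding G_def by (rule Un_Cinfinite_bound[OF le[OF M0(2)] _ inf2])
  qed
  obtain D where D: "strong K D M" "|univ D| \<le>o ctwo ^c \<mu>"
      "\<And>U. U \<subseteq> univ D \<Longrightarrow> U \<noteq> {} \<Longrightarrow> |U| \<le>o \<mu> \<Longrightarrow> G U \<subseteq> univ D"
    by (rule closed_submodel[where G = G, OF MK \<mu>(1-3) G]) blast
  have Dsm: "small_model K C D" using D(1) M by (rule small_model_strong)
  define OB where "OB = {B. ok B \<and> univ B \<subseteq> univ D}"
  \<comment> \<open>An index is exceptional if it lies in one of the finite sets attached to a base
    inside \<open>D\<close> and a type over it. There are at most \<open>ctwo ^c \<mu>\<close> bases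
    and at most that many types over each.\<close>
  define Bad where "Bad = (\<Union>B\<in>OB. \<Union>c\<in>types (univ B). S B c (A B c))"
  have "|OB| \<le>o |{U. U \<subseteq> univ D \<and> U \<noteq> {} \<and> |U| \<le>o \<mu>}|"
  proof (rule card_of_ordLeqI[where f = univ])
    show "inj_on univ OB" using ok_inj by (auto simp: inj_on_def OB_def)
    show "univ B \<in> {U. U \<subseteq> univ D \<and> U \<noteq> {} \<and> |U| \<le>o \<mu>}" if "B \<in> OB" for B
      using that strong_univ_nonempty[of B M] by (auto simp: OB_def ok_def)
  qed
  then have "|OB| \<le>o ctwo ^c \<mu>"
    using small_subsets_ctwo_cexp[OF D(2) inf] by (rule ordLeq_transitive)
  moreover have "\<forall>B\<in>OB. |\<Union>c\<in>types (univ B). S B c (A B c)| \<le>o ctwo ^c \<mu>"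
  proof
    fix B assume "B \<in> OB"
    then have B: "ok B" by (simp add: OB_def)
    have "\<forall>c\<in>types (univ B). |S B c (A B c)| \<le>o ctwo ^c \<mu>"
      using A[OF B] inf2 by (auto intro: finite_ordLeq_Cinfinite)
    with types[OF B] show "|\<Union>c\<in>types (univ B). S B c (A B c)| \<le>o ctwo ^c \<mu>"
      using inf2 by (rule UNION_Cinfinite_bound)
  qed
  ultimately have "|Bad| \<le>o ctwo ^c \<mu>" unfolding Bad_def using inf2 by (rule UNION_Cinfinite_bound)
  then have "\<not> I \<subseteq> Bad" using large ordLeq_transitive[OF card_of_mono1[of I Bad]] by blast
  then obtain p where p: "p \<in> I" "p \<notin> Bad" by blast
  have Np: "strong K (N p) M" "|univ (N p)| \<le>o \<mu>" "a p \<in> univ C" using I[OF p(1)] by auto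
  have NpC: "univ (N p) \<subseteq> univ C" using strong_univ[OF strong_trans[OF Np(1) MC]] .
  have Npsm: "small_set C (univ (N p))"
    using small_set_model[OF small_model_strong[OF Np(1) M]] .
  obtain M1 where M1: "strong K M1 D" "|univ M1| \<le>o \<mu>" "ind (univ (N p)) M1 (univ D)"
    using local_character_set[OF NpC strong_univ_nonempty[OF Np(1)] Np(2) inf \<mu>(3-5) Dsm] by blast
  have M0D: "univ M0 \<subseteq> univ D"
    using D(3)[OF strong_univ[OF M1(1)] strong_univ_nonempty[OF M1(1)] M1(2)] by (simp add: G_def)
  \<comment> \<open>The base \<open>B\<close> contains \<open>M1\<close> for the sake of base
    monotonicity and \<open>M0\<close> to be admissible.\<close>
  have "|univ M0 \<union> univ M1| \<le>o \<mu>" using M0(2) M1(2) inf by (rule Un_Cinfinite_bound)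
  then obtain B where B: "strong K B D" "univ M0 \<union> univ M1 \<subseteq> univ B" "|univ B| \<le>o \<mu>"
    using obtain_submodel[OF strongD(1)[OF D(1)] _ _ \<mu>(1,2), of "univ M0 \<union> univ M1"]
      M0D strong_univ[OF M1(1)] by blast
  have okB: "ok B" unfolding ok_def using strong_trans[OF B(1) D(1)] B(2,3) by blast
  have BD: "univ B \<subseteq> univ D" using B(1) by (rule strong_univ)
  have "strong K M1 B" using M1(1) B(1) by (rule coherence) (use B(2) in blast)
  then have indB: "ind (univ (N p)) B (univ D)"
    using ind_base_mono[OF M1(3) _ BD Npsm small_set_model[OF Dsm] small_model_strong[OF B(1) Dsm]]
    by blast
  define c where "c = gtp1 K C (a p) (univ B)"
  have c: "c \<in> types (univ B)" using Np(3) by (simp add: c_def types_def)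
  \<comment> \<open>The counterexample for \<open>B\<close> and the type of \<open>a p\<close> lies
    inside \<open>D\<close>. Monotonicity then puts \<open>p\<close> into its finite set, hence
    among the exceptional indices.\<close>
  have "G (univ B) \<subseteq> univ D" using BD strong_univ_nonempty[OF B(1)] B(3) by (rule D(3))
  then have "univ (A B c) \<subseteq> univ D" using okB c unfolding G_def by blast
  then have "ind (univ (N p)) B (univ (A B c))"
    using ind_mono[OF indB order_refl _ Npsm small_set_model[OF Dsm] small_model_strong[OF B(1) Dsm]]
    by blast
  then have "p \<in> S B c (A B c)" using p(1) by (simp add: S_def c_def)
  then have "p \<in> Bad" using okB BD c unfolding Bad_def OB_def by blast
  with p(2) show False ..
qed

section \<open>Amalgamating types along a chain\<close>

text \<open>Each step amalgamates the current type over \<open>A\<close> with the type of a fresh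
  \<open>a p\<close> over \<open>N p\<close>. Both restrict to \<open>c\<close> over
  \<open>B\<close> and do not fork over \<open>B\<close>, while \<open>A\<close> and
  \<open>N p\<close> are independent over \<open>B\<close>. A realization of the limit realizes all
  types met on the way.\<close>

lemma realize_infinitely_many:
  fixes I :: "'p set"
  assumes M: "small_model K C M"
    and \<mu>: "Card_order \<mu>" "LS K \<le>o \<mu>"
    and I: "\<And>p. p \<in> I \<Longrightarrow> a p \<in> univ C \<and> strong K (N p) M \<and> |univ (N p)| \<le>o \<mu> \<and> ind {a p} M0 (univ M)"
    and M0: "strong K M0 M"
    and B: "strong K B M" "|univ B| \<le>o \<mu>" "univ M0 \<subseteq> univ B"
    and many: "\<And>A. strong K A M \<Longrightarrow> univ B \<subseteq> univ A \<Longrightarrow> |univ A| \<le>o \<mu> \<Longrightarrow>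
      infinite {p\<in>I. gtp1 K C (a p) (univ B) = c \<and> ind (univ (N p)) B (univ A)}"
  obtains \<Delta> x where "\<Delta> \<subseteq> I" and "infinite \<Delta>" and "x \<in> univ C"
    and "\<forall>p\<in>\<Delta>. x \<in> gtp1 K C (a p) (univ (N p))"
proof -
  have inf: "Cinfinite \<mu>" using \<mu>(2,1) by (rule Cinfinite_if_LS_le)
  have MK: "M \<in> models K" and MC: "strong K M C"
    using M strongD(1)[of M C] by (auto simp: small_model_def)
  have Bsm: "small_model K C B" using B(1) M by (rule small_model_strong)
  have BC: "univ B \<subseteq> univ C" using strong_univ[OF strong_trans[OF B(1) MC]] .
  have sub: "univ X \<subseteq> univ M" if "strong K X M" for X using that by (rule strong_univ)
  have M0B: "strong K M0 B" using M0 B(1,3) by (rule coherence)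
  \<comment> \<open>Since \<open>M0\<close> lies below \<open>B\<close>, every \<open>a p\<close> is
    independent over \<open>B\<close> from all of \<open>M\<close>. This is the nonforking
    hypothesis for the second of the two types amalgamated later.\<close>
  have ind_a: "ind {a p} B X" if "p \<in> I" "X \<subseteq> univ M" for p X
  proof -
    have ap: "a p \<in> univ C" "ind {a p} M0 (univ M)" using I[OF that(1)] by auto
    have "ind {a p} B (univ M)"
      using ap(2) M0B sub[OF B(1)] small_set_singleton[OF ap(1)] small_set_model[OF M] Bsm
      by (rule ind_base_mono)
    then show ?thesis
      using order_refl that(2) small_set_singleton[OF ap(1)] small_set_model[OF M] Bsm
      by (rule ind_mono)
  qed
  \<comment> \<open>A state consists of a model, a realization of the current type over it, and the
    finite set of indices already used, which keeps later ones fresh.\<close>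
  define P where "P = (\<lambda>(A :: ('a, 'f, 'r) struct, b, F :: 'p set). strong K A M \<and> univ B \<subseteq> univ A \<and> |univ A| \<le>o \<mu> \<and> b \<in> univ C \<and>
      gtp1 K C b (univ B) = c \<and> ind {b} B (univ A) \<and> finite F)"
  define Q where "Q = (\<lambda>(A :: ('a, 'f, 'r) struct, b, F :: 'p set) (A' :: ('a, 'f, 'r) struct, b', F').
      univ A \<subseteq> univ A' \<and> b' \<in> gtp1 K C b (univ A) \<and>
      (\<exists>p\<in>I - F. F' = insert p F \<and> univ (N p) \<subseteq> univ A' \<and> b' \<in> gtp1 K C (a p) (univ (N p))))"
  have "\<exists>s. P s"
  proof -
    obtain p where p: "p \<in> I" "gtp1 K C (a p) (univ B) = c"
      using infinite_imp_nonempty[OF many[OF B(1) order_refl B(2)]] by blast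
    have "P (B, a p, {})"
      unfolding P_def using B(1,2) p I[OF p(1)] ind_a[OF p(1) sub[OF B(1)]] by simp
    then show ?thesis ..
  qed
  moreover have "\<exists>s'. P s' \<and> Q s s'" if "P s" for s
  proof -
    obtain A b F where s: "s = (A, b, F)" by (cases s)
    have A: "strong K A M" "univ B \<subseteq> univ A" "|univ A| \<le>o \<mu>"
      and b: "b \<in> univ C" "gtp1 K C b (univ B) = c" "ind {b} B (univ A)" and F: "finite F"
      using \<open>P s\<close> by (auto simp: s P_def)
    have "infinite ({p\<in>I. gtp1 K C (a p) (univ B) = c \<and> ind (univ (N p)) B (univ A)} - F)"
      using F many[OF A] by (rule Diff_infinite_finite)
    then obtain p where p: "p \<in> I" "p \<notin> F" "gtp1 K C (a p) (univ B) = c" "ind (univ (N p)) B (univ A)"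
      using infinite_imp_nonempty by blast
    have Np: "a p \<in> univ C" "strong K (N p) M" "|univ (N p)| \<le>o \<mu>" using I[OF p(1)] by auto
    have "|univ A \<union> univ (N p)| \<le>o \<mu>" using A(3) Np(3) inf by (rule Un_Cinfinite_bound)
    then obtain A' where A': "strong K A' M" "univ A \<union> univ (N p) \<subseteq> univ A'" "|univ A'| \<le>o \<mu>"
      using obtain_submodel[OF MK _ _ \<mu>, of "univ A \<union> univ (N p)"] sub[OF A(1)] sub[OF Np(2)] by blast
    have sA: "small_set C (univ A)" "small_set C (univ (N p))"
      using small_set_model small_model_strong[OF _ M] A(1) Np(2) by blast+
    \<comment> \<open>Type-amalgamation asks both sides to contain the base, so \<open>B\<close> is
      added to \<open>N p\<close>. Symmetry and normality give the independence in this
      form.\<close>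
    let ?X = "univ (N p) \<union> univ B"
    have "ind (univ A \<union> univ B) B ?X"
      using ind_normal[OF ind_sym[OF p(4) sA(2,1) Bsm] sA Bsm] .
    moreover have "univ A \<union> univ B = univ A" using A(2) by blast
    ultimately have AX: "ind (univ A) B ?X" by simp
    have X: "univ B \<subseteq> ?X" "?X \<subseteq> univ A'" "?X \<subseteq> univ M" "univ A \<subseteq> univ A'"
      using A'(2) A(2) sub[OF A'(1)] by auto
    obtain b' where b': "b' \<in> gtp1 K C b (univ A)" "b' \<in> gtp1 K C (a p) ?X" "ind {b'} B (univ A')"
      using amalgamate_elements[OF Bsm small_model_strong[OF A'(1) M] A(2) X(4,1,2) AX b(1,3) Np(1)
          ind_a[OF p(1) X(3)]] b(2) p(3) by metis
    have "gtp1 K C b' (univ B) = c"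
      using gtp1_eqI[OF gtp1_antimono[OF b'(1) A(2)] BC b(1)] b(2) by simp
    then have "P (A', b', insert p F)"
      unfolding P_def using A' A(2) gtp1_closed[OF b'(1) b(1)] b'(3) F by auto
    moreover have "b' \<in> gtp1 K C (a p) (univ (N p))" using b'(2) by (rule gtp1_antimono) simp
    then have "Q s (A', b', insert p F)" unfolding Q_def s using A'(2) b'(1) p(1,2) by auto
    ultimately show ?thesis by blast
  qed
  ultimately obtain s where s: "\<And>n. P (s n)" "\<And>n. Q (s n) (s (Suc n))"
    using dependent_nat_choice[of "\<lambda>_. P" "\<lambda>_. Q"] by metis
  define A where "A n = fst (s n)" for n
  define b where "b n = fst (snd (s n))" for n
  define F where "F n = snd (snd (s n))" for n
  have s_eq: "s n = (A n, b n, F n)" for n by (simp add: A_def b_def F_def)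
  have A: "strong K (A n) M" and b: "b n \<in> univ C" for n
    using s(1)[of n] by (auto simp: P_def s_eq)
  have Amono: "univ (A n) \<subseteq> univ (A (Suc n))" and bS: "b (Suc n) \<in> gtp1 K C (b n) (univ (A n))" for n
    using s(2)[of n] by (auto simp: Q_def s_eq)
  have "\<exists>p. p \<in> I - F n \<and> F (Suc n) = insert p (F n) \<and> univ (N p) \<subseteq> univ (A (Suc n)) \<and>
      b (Suc n) \<in> gtp1 K C (a p) (univ (N p))" for n
    using s(2)[of n] by (auto simp: Q_def s_eq)
  then obtain p where p: "\<And>n. p n \<in> I - F n" "\<And>n. F (Suc n) = insert (p n) (F n)"
      "\<And>n. univ (N (p n)) \<subseteq> univ (A (Suc n))"
      "\<And>n. b (Suc n) \<in> gtp1 K C (a (p n)) (univ (N (p n)))"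
    by metis
  obtain x where x: "x \<in> univ C" "\<And>n. x \<in> gtp1 K C (b n) (univ (A n))"
    using omega_type_limit[of M A b, OF M A Amono b bS] by metis
  show thesis
  proof (rule that)
    show "range p \<subseteq> I" using p(1) by blast
    \<comment> \<open>The sets \<open>F n\<close> only grow and contain each index once it is used,
      so the chosen indices are distinct.\<close>
    have "F n \<subseteq> F m" if "n \<le> m" for n m
      using that by (rule lift_Suc_mono_le[rotated]) (use p(2) in blast)
    then have pF: "p m \<in> F n" if "m < n" for m n
      using that p(2)[of m] Suc_leI[OF that] by blast
    have "p m \<noteq> p n" if "m < n" for m n using pF[OF that] p(1)[of n] by auto
    then have "inj p" by (rule linorder_injI)
    then show "infinite (range p)" using finite_imageD infinite_UNIV_nat by blast
    show "x \<in> univ C" by (rule x(1))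
    show "\<forall>q\<in>range p. x \<in> gtp1 K C (a q) (univ (N q))"
    proof clarify
      fix n
      \<comment> \<open>\<open>N (p n)\<close> is only known to lie in the model of stage
        \<open>Suc n\<close>, and it is \<open>b (Suc n)\<close> that realizes the type of
        \<open>a (p n)\<close> over \<open>N (p n)\<close>.\<close>
      have "x \<in> gtp1 K C (b (Suc n)) (univ (N (p n)))"
        using x(2) p(3) by (rule gtp1_antimono)
      then show "x \<in> gtp1 K C (a (p n)) (univ (N (p n)))"
        by (rule gtp1_trans[OF p(4)])
    qed
  qed
qed

section \<open>Counting families of types\<close>

text \<open>Local character finds the small base for the type over \<open>N\<close>, existence
  extends that type to \<open>M\<close> without forking over \<open>N\<close>, and transitivity
  joins the two. Replacing \<open>a\<close> by a realization of the extension leaves the type over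
  \<open>N\<close> unchanged.\<close>

lemma nonforking_representation:
  assumes M: "small_model K C M" and p: "p \<in> S_le K C M \<mu>"
  shows "\<exists>a N M0. a \<in> univ C \<and> p = gtp1 K C a (univ N) \<and> strong K N M \<and> |univ N| \<le>o \<mu> \<and>
    strong K M0 M \<and> |univ M0| \<le>o \<kappa> \<and> ind {a} M0 (univ M)"
proof -
  obtain a N where aN: "p = gtp1 K C a (univ N)" "a \<in> univ C" "strong K N M" "|univ N| \<le>o \<mu>"
    using p unfolding S_le_def by blast
  have N: "small_model K C N" using aN(3) M by (rule small_model_strong)
  obtain M0 where M0: "strong K M0 N" "|univ M0| \<le>o \<kappa>" "ind {a} M0 (univ N)"
    using aN(2) N by (rule local_character_element)
  obtain b where b: "b \<in> gtp1 K C a (univ N)" "ind {b} N (univ M)"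
    using aN(2,3) M by (rule nonforking_existence)
  have bC: "b \<in> univ C" using b(1) aN(2) by (rule gtp1_closed)
  have NC: "univ N \<subseteq> univ C" using small_set_model[OF N] by (simp add: small_set_def)
  obtain \<sigma> where \<sigma>: "\<sigma> \<in> Aut K C (univ N)" "b = \<sigma> a" using b(1) by (rule gtp1E)
  have "ind (\<sigma> ` {a}) M0 (univ N)"
    using \<sigma>(1) strong_univ[OF M0(1)] small_set_singleton[OF aN(2)] small_set_model[OF N]
      small_model_strong[OF M0(1) N] M0(3) by (rule ind_invariant)
  then have "ind {b} M0 (univ N)" by (simp add: \<sigma>(2))
  then have "ind {b} M0 (univ M)"
    using b(2) M0(1) small_set_singleton[OF bC] small_set_model[OF M] N by (rule ind_trans)
  moreover have "p = gtp1 K C b (univ N)" unfolding aN(1) using gtp1_eqI[OF b(1) NC aN(2)] by simp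
  moreover have "strong K M0 M" using M0(1) aN(3) by (rule strong_trans)
  ultimately show ?thesis using bC aN(3,4) M0(2) by blast
qed

lemma card_of_inconsistent_types:
  assumes M: "strong K M C" "|univ M| =o lam" "lam <o |univ C|"
    and \<mu>: "Card_order \<mu>" "LS K \<le>o \<mu>" "\<mu> <o |univ C|" "\<kappa> \<le>o \<mu>" "cpow_less \<mu> \<theta> =o \<mu>"
    and \<Gamma>: "\<Gamma> \<subseteq> S_le K C M \<mu>" "\<forall>\<Delta>\<subseteq>\<Gamma>. infinite \<Delta> \<longrightarrow> \<not> consistent C \<Delta>"
  shows "|\<Gamma>| \<le>o (lam ^c \<kappa>) +c (ctwo ^c \<mu>)"
proof (rule ccontr)
  let ?R = "(lam ^c \<kappa>) +c (ctwo ^c \<mu>)"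
  assume large: "\<not> |\<Gamma>| \<le>o ?R"
  have inf: "Cinfinite \<mu>" using \<mu>(2,1) by (rule Cinfinite_if_LS_le)
  have R: "Cinfinite ?R" using Cinfinite_ctwo_cexp[OF inf] by (intro Cinfinite_csum) simp
  have Msm: "small_model K C M"
    using M(1) ordIso_ordLess_trans[OF M(2,3)] by (simp add: small_model_def)
  obtain a N M0 where rep: "\<And>p. p \<in> \<Gamma> \<Longrightarrow> a p \<in> univ C \<and> p = gtp1 K C (a p) (univ (N p)) \<and>
      strong K (N p) M \<and> |univ (N p)| \<le>o \<mu> \<and> strong K (M0 p) M \<and> |univ (M0 p)| \<le>o \<kappa> \<and>
      ind {a p} (M0 p) (univ M)"
  proof -
    have "\<forall>p. \<exists>a N M0. p \<in> \<Gamma> \<longrightarrow> a \<in> univ C \<and> p = gtp1 K C a (univ N) \<and> strong K N M \<and>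
        |univ N| \<le>o \<mu> \<and> strong K M0 M \<and> |univ M0| \<le>o \<kappa> \<and> ind {a} M0 (univ M)"
      using nonforking_representation[OF Msm] \<Gamma>(1) by blast
    then show ?thesis unfolding choice_iff using that by blast
  qed
  let ?U = "{U. U \<subseteq> univ M \<and> U \<noteq> {} \<and> |U| \<le>o \<kappa>}"
  \<comment> \<open>The types are sorted by the universe of their base. There are at most
    \<open>lam ^c \<kappa>\<close> classes, so one of them has to exceed \<open>?R\<close>.\<close>
  define I where "I U = {p\<in>\<Gamma>. univ (M0 p) = U}" for U
  have "\<Gamma> = (\<Union>U\<in>?U. I U)"
  proof
    show "\<Gamma> \<subseteq> (\<Union>U\<in>?U. I U)"
    proof
      fix p assume p: "p \<in> \<Gamma>"
      have "univ (M0 p) \<in> ?U"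
        using rep[OF p] strong_univ[of "M0 p" M] strong_univ_nonempty[of "M0 p" M] by simp
      then show "p \<in> (\<Union>U\<in>?U. I U)" using p unfolding I_def by blast
    qed
  qed (auto simp: I_def)
  moreover have "|?U| \<le>o ?R"
  proof -
    have "|?U| \<le>o |univ M| ^c \<kappa>" using kappa_Cinfinite by (intro card_of_small_subsets) blast
    also have "|univ M| ^c \<kappa> \<le>o lam ^c \<kappa>"
      using ordIso_imp_ordLeq[OF M(2)] kappa_Cinfinite by (intro cexp_mono1) blast+
    also have "lam ^c \<kappa> \<le>o ?R" by (rule ordLeq_csum1[OF Card_order_cexp])
    finally show ?thesis .
  qed
  ultimately obtain U where U: "\<not> |I U| \<le>o ?R"
    using large UNION_Cinfinite_bound[of ?U ?R I] R by (metis (no_types, lifting))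
  have largeI: "\<not> |I U| \<le>o ctwo ^c \<mu>"
    using U ordLeq_transitive[OF _ ordLeq_csum2[OF Card_order_cexp], of "|I U|" ctwo \<mu> "lam ^c \<kappa>"] by blast
  have "I U \<noteq> {}" using U finite_ordLeq_Cinfinite[OF _ R, of "I U"] by auto
  then obtain p0 where p0: "p0 \<in> \<Gamma>" "univ (M0 p0) = U" unfolding I_def by blast
  have M0: "strong K (M0 p0) M" "|univ (M0 p0)| \<le>o \<kappa>" using rep[OF p0(1)] by auto
  \<comment> \<open>Submodels of \<open>M\<close> with equal universes are equal, so a whole class
    shares one base.\<close>
  have M0_eq: "M0 p = M0 p0" if "p \<in> I U" for p
    using that p0 rep[of p] M0(1) strong_univ_inject[of "M0 p" M "M0 p0"] by (auto simp: I_def)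
  have I: "a p \<in> univ C \<and> strong K (N p) M \<and> |univ (N p)| \<le>o \<mu> \<and> ind {a p} (M0 p0) (univ M)"
    if "p \<in> I U" for p
    using rep[of p] that M0_eq[OF that] by (auto simp: I_def)
  have "|univ (M0 p0)| \<le>o \<mu>" using M0(2) \<mu>(4) by (rule ordLeq_transitive)
  then obtain B c where B: "strong K B M" "|univ B| \<le>o \<mu>" "univ (M0 p0) \<subseteq> univ B"
      "\<And>A. strong K A M \<Longrightarrow> univ B \<subseteq> univ A \<Longrightarrow> |univ A| \<le>o \<mu> \<Longrightarrow>
        infinite {p\<in>I U. gtp1 K C (a p) (univ B) = c \<and> ind (univ (N p)) B (univ A)}"
    using independent_base[OF Msm \<mu> _ M0(1) _ largeI, of a N] I by blast
  obtain \<Delta> x where \<Delta>: "\<Delta> \<subseteq> I U" "infinite \<Delta>" "x \<in> univ C"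
      "\<forall>p\<in>\<Delta>. x \<in> gtp1 K C (a p) (univ (N p))"
    using Msm \<mu>(1,2) I M0(1) B by (rule realize_infinitely_many)
  have sub: "\<Delta> \<subseteq> \<Gamma>" using \<Delta>(1) by (auto simp: I_def)
  then have "\<forall>p\<in>\<Delta>. x \<in> p" using \<Delta>(4) rep by blast
  then have "consistent C \<Delta>" using \<Delta>(3) unfolding consistent_def by blast
  with \<Gamma>(2) sub \<Delta>(2) show False by blast
qed

end

theorem theorem5p12:
  fixes K :: "('a, 'f, 'r) aclass"
    and C :: "('a, 'f, 'r) struct"
    and ind :: "('a, 'f, 'r) indep"
    and \<mu> lam :: "'a rel"
  assumes "aec K"
    and "joint_embedding K"
    and "amalgamation K"
    and "no_maximal_models K"
    and "monster K C"
    and "simple_independence_relation K C ind"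
    and "Card_order \<mu>" and "Card_order lam"
    and "LS K \<le>o \<mu>" and "\<mu> \<le>o lam" and "lam <o |univ C|"
    and "kappa_ind K C ind \<le>o \<mu>"
    and "cpow_less \<mu> (ell_ind K C ind) =o \<mu>"
  shows "NT K C \<mu> lam natLeq \<le>o (lam ^c kappa_ind K C ind) +c (ctwo ^c \<mu>)
    \<and> NT K C \<mu> lam ctwo \<le>o (lam ^c kappa_ind K C ind) +c (ctwo ^c \<mu>)"
proof -
  interpret simple_class K C ind
    by unfold_locales (use assms(1,5,6) in auto)
  have \<mu>C: "\<mu> <o |univ C|" using assms(10,11) by (rule ordLeq_ordLess_trans)
  \<comment> \<open>Both thresholds are treated together: each is at most every infinite cardinal,
    so all infinite subsets of the families considered are inconsistent.\<close>
  have bound: "NT K C \<mu> lam \<nu> \<le>o (lam ^c kappa_ind K C ind) +c (ctwo ^c \<mu>)"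
    if \<nu>: "\<And>\<Delta> :: 'a set set. infinite \<Delta> \<Longrightarrow> \<nu> \<le>o |\<Delta>|" for \<nu> :: "'k rel"
    unfolding NT_def
  proof (rule csup_least)
    show "Card_order ((lam ^c kappa_ind K C ind) +c (ctwo ^c \<mu>))" by (rule Card_order_csum)
    let ?S = "{\<Gamma>. \<exists>M. strong K M C \<and> |univ M| =o lam \<and> \<Gamma> \<subseteq> S_le K C M \<mu> \<and>
      (\<forall>\<Delta>\<subseteq>\<Gamma>. \<nu> \<le>o |\<Delta>| \<longrightarrow> \<not> consistent C \<Delta>)}"
    show "\<forall>s\<in>card_of ` ?S. Card_order s" using card_of_Card_order by blast
    have "|\<Gamma>| \<le>o (lam ^c kappa_ind K C ind) +c (ctwo ^c \<mu>)" if \<Gamma>: "\<Gamma> \<in> ?S" for \<Gamma>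
    proof -
      obtain M where M: "strong K M C" "|univ M| =o lam" "\<Gamma> \<subseteq> S_le K C M \<mu>"
          "\<forall>\<Delta>\<subseteq>\<Gamma>. \<nu> \<le>o |\<Delta>| \<longrightarrow> \<not> consistent C \<Delta>"
        using \<Gamma> by blast
      show ?thesis
        by (rule card_of_inconsistent_types[OF M(1,2) assms(11,7,9) \<mu>C assms(12,13) M(3)])
          (use M(4) \<nu> in blast)
    qed
    then show "\<forall>s\<in>card_of ` ?S. s \<le>o (lam ^c kappa_ind K C ind) +c (ctwo ^c \<mu>)" by blast
  qed
  have nat: "natLeq \<le>o |\<Delta>|" if "infinite \<Delta>" for \<Delta> :: "'a set set"
    using that infinite_iff_natLeq_ordLeq by blast
  have two: "ctwo \<le>o |\<Delta>|" if "infinite \<Delta>" for \<Delta> :: "'a set set"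
    using ordLess_imp_ordLeq[OF ctwo_ordLess_natLeq] nat[OF that] by (rule ordLeq_transitive)
  show ?thesis using bound[OF nat] bound[OF two] by simp
qed

end
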